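(* Let $k$ be a positive integer and $q=3^{k}$. Then there exists a flag-transitive non-Desarguesian linear space with $q^{6}$ points and with $q^{2}$ points on each line that admits a flag-transitive one-dimensional affine automorphism group.
   Context: A finite linear space $\mathcal{L}$ is a point-line incidence structure with finitely many points such that any two distinct points lie on exactly one common line, any point lies on at least two lines, and any line is incident with at least two points. It is non-trivial if some line has more than two points, and nondegenerate if it has four points no three of which are collinear. All linear spaces are assumed finite, non-trivial and nondegenerate. An automorphism of $\mathcal{L}$ consists of a permutation of the points and a permutation of the lines that preserve incidence; an automorphism group of $\mathcal{L}$ is any subgroup of the full automorphism group $\mathrm{Aut}(\mathcal{L})$. A flag is an incident point-line pair. An automorphism group is flag-transitive if it acts transitively on the flags of $\mathcal{L}$, and $\mathcal{L}$ is flag-transitive if it has a flag-transitive automorphism group. An automorphism group $G$ of a linear space whose number of points is a power $p^{f}$ of a prime $p$ (here $p=3$) is called one-dimensional affine if the point set can be identified with the field $\mathbb{F}_{p^{f}}$ in such a way that $G$ contains all translations $x\mapsto x+v$ ($v\in\mathbb{F}_{p^f}$) and $G\le \mathrm{A\Gamma L}_{1}(p^{f})=\{x\mapsto a x^{\sigma}+v : a\in\mathbb{F}_{p^f}^{*},\ v\in\mathbb{F}_{p^f},\ \sigma\in\mathrm{Aut}(\mathbb{F}_{p^f})\}$. A linear space with $q^{6}$ points and $q^2$ points on each line is Desarguesian if it is isomorphic to the Desarguesian affine space whose points are the vectors of $\mathbb{F}_{q^{2}}^{3}$ and whose lines are the cosets of the one-dimensional $\mathbb{F}_{q^2}$-subspaces;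 otherwise it is non-Desarguesian. *)

theory Defs
  imports "HOL-Algebra.Algebra"
begin

section \<open>Linear spaces\<close>

text \<open>Incidence is only ever consulted on \<open>points L \<times> lines L\<close>.\<close>

record ('p, 'l) incidence_structure =
  points :: "'p set"
  lines :: "'l set"
  inc :: "'p \<Rightarrow> 'l \<Rightarrow> bool"

definition collinear :: "('p, 'l) incidence_structure \<Rightarrow> 'p set \<Rightarrow> bool" where
  "collinear L S \<longleftrightarrow> (\<exists>l\<in>lines L. \<forall>x\<in>S. inc L x l)"

text \<open>Non-triviality and nondegeneracy are part of the notion.\<close>

locale linear_space =
  fixes L :: "('p, 'l) incidence_structure"
  assumes finite_points: "finite (points L)"
    and joining_line: "\<lbrakk>x \<in> points L; y \<in> points L; x \<noteq> y\<rbrakk> \<Longrightarrow> \<exists>!l. l \<in> lines L \<and> inc L x l \<and> inc L y l"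
    and two_lines_on_point: "x \<in> points L \<Longrightarrow>
      \<exists>l m. l \<in> lines L \<and> m \<in> lines L \<and> l \<noteq> m \<and> inc L x l \<and> inc L x m"
    and two_points_on_line: "l \<in> lines L \<Longrightarrow>
      \<exists>x y. x \<in> points L \<and> y \<in> points L \<and> x \<noteq> y \<and> inc L x l \<and> inc L y l"
    and nontrivial: "\<exists>l\<in>lines L. card {x \<in> points L. inc L x l} > 2"
    and nondegenerate: "\<exists>S\<subseteq>points L. card S = 4 \<and> (\<forall>T\<subseteq>S. card T = 3 \<longrightarrow> \<not> collinear L T)"


section \<open>Automorphism groups\<close>

definition automorphism_group_of ::
    "('p, 'l) incidence_structure \<Rightarrow> (('p \<Rightarrow> 'p) \<times> ('l \<Rightarrow> 'l)) monoid" where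
  "automorphism_group_of L =
     (BijGroup (points L) \<times>\<times> BijGroup (lines L))
       \<lparr>carrier := {(g, h). g \<in> Bij (points L) \<and> h \<in> Bij (lines L) \<and>
          (\<forall>x\<in>points L. \<forall>l\<in>lines L. inc L (g x) (h l) \<longleftrightarrow> inc L x l)}\<rparr>"

lemma group_automorphism_group_of: "group (automorphism_group_of L)"
proof -
  let ?P = "BijGroup (points L) \<times>\<times> BijGroup (lines L)"
  let ?A = "carrier (automorphism_group_of L)"
  interpret P: group ?P
    by (intro DirProd_group group_BijGroup)
  have "subgroup ?A ?P"
  proof (rule P.subgroupI)
    show "?A \<subseteq> carrier ?P"
      by (auto simp: automorphism_group_of_def DirProd_def BijGroup_def)
    have "((\<lambda>x\<in>points L. x), (\<lambda>l\<in>lines L. l)) \<in> ?A"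
      by (simp add: automorphism_group_of_def id_Bij)
    then show "?A \<noteq> {}" by blast
  next
    fix a assume a: "a \<in> ?A"
    obtain g h where gh: "a = (g, h)" by (cases a)
    have B: "g \<in> Bij (points L)" "h \<in> Bij (lines L)"
      and i: "\<And>x l. x \<in> points L \<Longrightarrow> l \<in> lines L \<Longrightarrow> inc L (g x) (h l) \<longleftrightarrow> inc L x l"
      using a gh by (auto simp: automorphism_group_of_def)
    have "inv\<^bsub>?P\<^esub> a = (restrict (inv_into (points L) g) (points L), restrict (inv_into (lines L) h) (lines L))"
      using B inv_DirProd[OF group_BijGroup group_BijGroup, of g "points L" h "lines L"]
      by (simp add: gh inv_BijGroup) (simp add: BijGroup_def)
    moreover have "inc L (inv_into (points L) g x) (inv_into (lines L) h l) \<longleftrightarrow> inc L x l"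
      if "x \<in> points L" "l \<in> lines L" for x l
      using i[of "inv_into (points L) g x" "inv_into (lines L) h l"] B that
      by (simp add: Bij_inv_into_mem Bij_def bij_betw_inv_into_right bij_betw_def inv_into_into f_inv_into_f)
    ultimately show "inv\<^bsub>?P\<^esub> a \<in> ?A"
      using B by (simp add: automorphism_group_of_def restrict_inv_into_Bij)
  next
    fix a b assume "a \<in> ?A" "b \<in> ?A"
    then show "a \<otimes>\<^bsub>?P\<^esub> b \<in> ?A"
      by (auto simp: automorphism_group_of_def BijGroup_def compose_Bij compose_eq
          funcset_mem[OF Bij_imp_funcset])
  qed
  then have "group (?P\<lparr>carrier := ?A\<rparr>)"
    by (rule P.subgroup_imp_group)
  then show ?thesis
    by (simp add: automorphism_group_of_def)
qed

definition flags :: "('p, 'l) incidence_structure \<Rightarrow> ('p \<times> 'l) set" where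
  "flags L = {(x, l). x \<in> points L \<and> l \<in> lines L \<and> inc L x l}"

definition flag_transitive_group ::
    "('p, 'l) incidence_structure \<Rightarrow> (('p \<Rightarrow> 'p) \<times> ('l \<Rightarrow> 'l)) set \<Rightarrow> bool" where
  "flag_transitive_group L G \<longleftrightarrow>
     subgroup G (automorphism_group_of L) \<and>
     (\<forall>(x, l)\<in>flags L. \<forall>(y, m)\<in>flags L. \<exists>(g, h)\<in>G. g x = y \<and> h l = m)"

definition flag_transitive :: "('p, 'l) incidence_structure \<Rightarrow> bool" where
  "flag_transitive L \<longleftrightarrow> (\<exists>G. flag_transitive_group L G)"


section \<open>One-dimensional affine groups\<close>

text \<open>
  Permutations of the carrier are represented as extensional functions, as in \<^const>\<open>Bij\<close>.
\<close>

definition translation_maps :: "('a, 'b) ring_scheme \<Rightarrow> ('a \<Rightarrow> 'a) set" where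
  "translation_maps F = {(\<lambda>x\<in>carrier F. x \<oplus>\<^bsub>F\<^esub> v) | v. v \<in> carrier F}"

definition AGammaL1 :: "('a, 'b) ring_scheme \<Rightarrow> ('a \<Rightarrow> 'a) set" where
  "AGammaL1 F = {(\<lambda>x\<in>carrier F. a \<otimes>\<^bsub>F\<^esub> \<sigma> x \<oplus>\<^bsub>F\<^esub> v) | a v \<sigma>.
     a \<in> carrier F - {\<zero>\<^bsub>F\<^esub>} \<and> v \<in> carrier F \<and> \<sigma> \<in> ring_iso F F}"

text \<open>
  Identifying the point set with a finite field means putting a field structure on it.
  The order of that field, being the number of points, is then a prime power.
  The condition on \<open>G\<close> concerns its action on points.
\<close>

definition one_dimensional_affine ::
    "('p, 'l) incidence_structure \<Rightarrow> (('p \<Rightarrow> 'p) \<times> ('l \<Rightarrow> 'l)) set \<Rightarrow> bool" where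
  "one_dimensional_affine L G \<longleftrightarrow>
     subgroup G (automorphism_group_of L) \<and>
     (\<exists>F :: 'p ring. field F \<and> carrier F = points L \<and>
        translation_maps F \<subseteq> fst ` G \<and> fst ` G \<subseteq> AGammaL1 F)"


section \<open>Desarguesian linear spaces\<close>

definition isomorphic ::
    "('p, 'l) incidence_structure \<Rightarrow> ('q, 'm) incidence_structure \<Rightarrow> bool" where
  "isomorphic L M \<longleftrightarrow>
     (\<exists>g h. bij_betw g (points L) (points M) \<and> bij_betw h (lines L) (lines M) \<and>
        (\<forall>x\<in>points L. \<forall>l\<in>lines L. inc M (g x) (h l) \<longleftrightarrow> inc L x l))"

fun vec3_add :: "('a, 'b) ring_scheme \<Rightarrow> 'a \<times> 'a \<times> 'a \<Rightarrow> 'a \<times> 'a \<times> 'a \<Rightarrow> 'a \<times> 'a \<times> 'a" where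
  "vec3_add K (x, y, z) (x', y', z') = (x \<oplus>\<^bsub>K\<^esub> x', y \<oplus>\<^bsub>K\<^esub> y', z \<oplus>\<^bsub>K\<^esub> z')"

fun vec3_smult :: "('a, 'b) ring_scheme \<Rightarrow> 'a \<Rightarrow> 'a \<times> 'a \<times> 'a \<Rightarrow> 'a \<times> 'a \<times> 'a" where
  "vec3_smult K c (x, y, z) = (c \<otimes>\<^bsub>K\<^esub> x, c \<otimes>\<^bsub>K\<^esub> y, c \<otimes>\<^bsub>K\<^esub> z)"

definition vec3_carrier :: "('a, 'b) ring_scheme \<Rightarrow> ('a \<times> 'a \<times> 'a) set" where
  "vec3_carrier K = carrier K \<times> carrier K \<times> carrier K"

definition one_dim_subspaces :: "('a, 'b) ring_scheme \<Rightarrow> ('a \<times> 'a \<times> 'a) set set" where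
  "one_dim_subspaces K =
     {{vec3_smult K c w | c. c \<in> carrier K} | w. w \<in> vec3_carrier K - {(\<zero>\<^bsub>K\<^esub>, \<zero>\<^bsub>K\<^esub>, \<zero>\<^bsub>K\<^esub>)}}"

definition desarguesian_affine_space ::
    "('a, 'b) ring_scheme \<Rightarrow> ('a \<times> 'a \<times> 'a, ('a \<times> 'a \<times> 'a) set) incidence_structure" where
  "desarguesian_affine_space K =
     \<lparr>points = vec3_carrier K,
      lines = {vec3_add K v ` W | v W. v \<in> vec3_carrier K \<and> W \<in> one_dim_subspaces K},
      inc = (\<in>)\<rparr>"

text \<open>
  For a linear space with \<open>q ^ 6\<close> points and \<open>q\<^sup>2\<close> points on each line. Every finite field has an
  isomorphic copy with carrier in \<^typ>\<open>nat\<close>, so the type of \<open>K\<close> is no restriction.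
\<close>

definition desarguesian :: "nat \<Rightarrow> ('p, 'l) incidence_structure \<Rightarrow> bool" where
  "desarguesian q L \<longleftrightarrow>
     (\<exists>K :: nat ring. field K \<and> card (carrier K) = q ^ 2 \<and>
        isomorphic L (desarguesian_affine_space K))"

end

theory Submission
  imports Defs "HOL-Algebra.Algebraic_Closure_Type"
begin

text \<open>
  Let \<open>F\<close> be the field with \<open>q ^ 6\<close> elements and \<open>N = q ^ 4 + q\<^sup>2 + 1\<close>, so that \<open>z \<mapsto> z ^ N\<close> is the norm
  from \<open>F\<close> to its subfield with \<open>q\<^sup>2\<close> elements. Suppose that \<open>\<ell>\<close> is an additive subgroup of \<open>F\<close> with
  \<open>q\<^sup>2\<close> elements on which the norm is injective. Then the norm maps \<open>\<ell>\<close> onto the subfield, and every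
  nonzero \<open>z\<close> can be written in exactly one way as \<open>c * u\<close> with \<open>c\<close> in the group \<open>C\<close> of elements of
  norm 1 and \<open>u \<in> \<ell>\<close>. Hence the sets \<open>c * \<ell>\<close> with \<open>c \<in> C\<close> partition the nonzero elements of \<open>F\<close>, and
  \<open>C\<close> permutes them transitively. The cosets of these subgroups are the lines of a linear space on
  \<open>F\<close>, and the maps \<open>x \<mapsto> c * x + v\<close> with \<open>c \<in> C\<close> and \<open>v \<in> F\<close> act transitively on its flags, because
  translations reduce the question to lines through \<open>0\<close>.

  To find \<open>\<ell>\<close>, choose \<open>\<beta>\<close> with \<open>\<beta> ^ q = - \<beta>\<close> and \<open>s\<close> with \<open>s ^ q = s + 1\<close>, put \<open>\<omega> = \<beta> * s\<close>, and let \<open>\<ell>\<close>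
  consist of the \<open>x + y * \<omega>\<close> with \<open>x\<close> and \<open>y\<close> in the field with \<open>q\<close> elements. The conjugates of \<open>s\<close> are
  \<open>s\<close>, \<open>s + 1\<close> and \<open>s - 1\<close>, so the norm is \<open>x ^ 3 - y\<^sup>2 * \<beta>\<^sup>2 * x + y ^ 3 * \<beta> ^ 3 * (s ^ 3 - s)\<close>
  (lemma \<open>power_N_base\<close>). Raising to the power \<open>q\<close> fixes the sum of the first two terms and negates
  the last one, so the norm determines \<open>y ^ 3\<close> and therefore \<open>y\<close>, cubing being injective. For fixed
  \<open>y\<close>, the map \<open>x \<mapsto> x ^ 3 - y\<^sup>2 * \<beta>\<^sup>2 * x\<close> is additive, and its kernel is trivial because \<open>\<plusminus> y * \<beta>\<close> is fixed
  by the power \<open>q\<close> only if \<open>y = 0\<close>. So the norm is injective on \<open>\<ell>\<close> (lemma \<open>power_N_inj\<close>).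

  Why the space is not Desarguesian: a Desarguesian affine space has small planes and enough
  dilatations, both of which can be expressed by incidence (\<open>planar\<close>, \<open>dilatable\<close>). If the space on
  \<open>F\<close> had them, then there would be a dilatation \<open>d\<close> with \<open>d 0 = 0\<close> and \<open>d 1 = \<omega>\<close>, since \<open>1\<close> and \<open>\<omega>\<close> lie
  on the line \<open>\<ell>\<close>. It would be additive (lemma \<open>dilatation_additive\<close>) and preserve each \<open>c * \<ell>\<close>.
  Additive maps with this property are determined by their value at \<open>1\<close>. Comparing \<open>d\<close> with its
  conjugates under \<open>C\<close> therefore gives \<open>d (c * x) = c * (a * x + b * d x)\<close> with \<open>a\<close> and \<open>b\<close> in the field
  with \<open>q\<close> elements, and iterating this \<open>N\<close> times forces \<open>b = 1\<close> and \<open>a = 0\<close>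
  (lemma \<open>kernel_commutes_norm_group\<close>). The elements of \<open>F\<close> whose multiplication commutes with \<open>d\<close>
  form a subfield that contains \<open>C\<close>, which is too large for a proper subfield. So
  \<open>d\<close> is multiplication by \<open>\<omega>\<close>, and \<open>\<omega> * \<omega> = d \<omega>\<close> lies in \<open>\<ell>\<close>, which is impossible because \<open>s\<close> has
  degree 3 over the field with \<open>q\<^sup>2\<close> elements.
\<close>

section \<open>Planes and dilatations in terms of incidence\<close>

abbreviation set_space :: "'a set \<Rightarrow> 'a set set \<Rightarrow> ('a, 'a set) incidence_structure" where
  "set_space P \<Lambda> \<equiv> \<lparr>points = P, lines = \<Lambda>, inc = (\<in>)\<rparr>"

text \<open>
  Any three points lie in a subspace with at most \<open>n\<close> points; in an affine space over a field with
  \<open>r\<close> elements, planes show this for \<open>n = r\<^sup>2\<close>.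
\<close>

definition planar :: "'a set \<Rightarrow> 'a set set \<Rightarrow> nat \<Rightarrow> bool" where
  "planar P \<Lambda> n \<longleftrightarrow> (\<forall>o'\<in>P. \<forall>a\<in>P. \<forall>b\<in>P. \<exists>W\<subseteq>P. {o', a, b} \<subseteq> W \<and> card W \<le> n \<and>
     (\<forall>l\<in>\<Lambda>. \<forall>x\<in>W \<inter> l. \<forall>y\<in>W \<inter> l. x \<noteq> y \<longrightarrow> l \<subseteq> W))"

text \<open>
  Asking for disjoint images rather than for parallel ones keeps the notion a matter of incidence, so
  that it can be carried along any isomorphism of linear spaces.
\<close>

definition dilatation :: "'a set \<Rightarrow> 'a set set \<Rightarrow> ('a \<Rightarrow> 'a) \<Rightarrow> bool" where
  "dilatation P \<Lambda> \<delta> \<longleftrightarrow> bij_betw \<delta> P P \<and> (\<forall>m\<in>\<Lambda>. \<delta> ` m \<in> \<Lambda> \<and> (\<delta> ` m = m \<or> \<delta> ` m \<inter> m = {}))"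

text \<open>
  The homotheties with a given center are transitive on the other points of each line through it. For
  affine planes this is equivalent to Desargues' theorem.
\<close>

definition dilatable :: "'a set \<Rightarrow> 'a set set \<Rightarrow> bool" where
  "dilatable P \<Lambda> \<longleftrightarrow> (\<forall>l\<in>\<Lambda>. \<forall>c\<in>l. \<forall>a\<in>l. \<forall>b\<in>l. a \<noteq> c \<longrightarrow> b \<noteq> c \<longrightarrow>
     (\<exists>\<delta>. dilatation P \<Lambda> \<delta> \<and> \<delta> c = c \<and> \<delta> a = b))"

lemma planar_pullback:
  assumes f: "bij_betw f P Q" and M: "M = (`) f ` \<Lambda>" and sub: "\<Lambda> \<subseteq> Pow P" and planar: "planar Q M n"
  shows "planar P \<Lambda> n"
  unfolding planar_def
proof (intro ballI)
  fix o' a b assume P: "o' \<in> P" "a \<in> P" "b \<in> P"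
  have inj: "inj_on f P" and fP: "f ` P = Q"
    using f by (auto simp: bij_betw_def)
  obtain W where W: "W \<subseteq> Q" "{f o', f a, f b} \<subseteq> W" "card W \<le> n"
    and cl: "\<And>l x y. l \<in> M \<Longrightarrow> x \<in> W \<inter> l \<Longrightarrow> y \<in> W \<inter> l \<Longrightarrow> x \<noteq> y \<Longrightarrow> l \<subseteq> W"
    using planar P fP unfolding planar_def by (metis imageI)
  define V where "V = {x \<in> P. f x \<in> W}"
  have fV: "f ` V = W"
    using W(1) fP unfolding V_def by auto
  have "card V = card W"
    using fV inj by (metis (no_types, lifting) V_def card_image inj_on_subset mem_Collect_eq subsetI)
  moreover have "l \<subseteq> V" if l: "l \<in> \<Lambda>" "x \<in> V \<inter> l" "y \<in> V \<inter> l" "x \<noteq> y" for l x y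
  proof -
    have "f ` l \<subseteq> W"
    proof (rule cl)
      show "f ` l \<in> M" using l M by blast
      show "f x \<in> W \<inter> f ` l" "f y \<in> W \<inter> f ` l" using l by (auto simp: V_def)
      show "f x \<noteq> f y" using l inj by (auto simp: V_def inj_on_def)
    qed
    then show ?thesis using l sub by (auto simp: V_def)
  qed
  ultimately show "\<exists>W\<subseteq>P. {o', a, b} \<subseteq> W \<and> card W \<le> n \<and>
     (\<forall>l\<in>\<Lambda>. \<forall>x\<in>W \<inter> l. \<forall>y\<in>W \<inter> l. x \<noteq> y \<longrightarrow> l \<subseteq> W)"
    using W P by (intro exI[of _ V]) (auto simp: V_def)
qed

lemma dilatation_pullback:
  assumes f: "bij_betw f P Q" and M: "M = (`) f ` \<Lambda>" and sub: "\<Lambda> \<subseteq> Pow P" and \<delta>: "dilatation Q M \<delta>"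
  shows "dilatation P \<Lambda> (inv_into P f \<circ> \<delta> \<circ> f)" (is "dilatation P \<Lambda> ?\<epsilon>")
proof -
  have inj: "inj_on f P" and fP: "f ` P = Q"
    using f by (auto simp: bij_betw_def)
  have \<delta>Q: "bij_betw \<delta> Q Q"
    using \<delta> by (simp add: dilatation_def)
  have bij: "bij_betw ?\<epsilon> P P"
    using bij_betw_trans[OF bij_betw_trans[OF f \<delta>Q] bij_betw_inv_into[OF f]] by (simp add: comp_assoc)
  have f\<epsilon>: "f (?\<epsilon> x) = \<delta> (f x)" if "x \<in> P" for x
  proof -
    have "\<delta> (f x) \<in> f ` P"
      using that fP bij_betw_apply[OF \<delta>Q] by auto
    then show ?thesis by (simp add: f_inv_into_f)
  qed
  have "?\<epsilon> ` m \<in> \<Lambda> \<and> (?\<epsilon> ` m = m \<or> ?\<epsilon> ` m \<inter> m = {})" if m: "m \<in> \<Lambda>" for m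
  proof -
    have mP: "m \<subseteq> P" and \<epsilon>m: "?\<epsilon> ` m \<subseteq> P"
      using sub m bij by (auto simp: bij_betw_def)
    have im: "f ` ?\<epsilon> ` m = \<delta> ` f ` m"
      using f\<epsilon> mP by (force simp: image_iff)
    have "f ` m \<in> M" using m M by blast
    then have d: "\<delta> ` f ` m \<in> M" "\<delta> ` f ` m = f ` m \<or> \<delta> ` f ` m \<inter> f ` m = {}"
      using \<delta> by (auto simp: dilatation_def)
    obtain m' where m': "m' \<in> \<Lambda>" "\<delta> ` f ` m = f ` m'"
      using d(1) M by blast
    then have "?\<epsilon> ` m = m'"
      using im inj \<epsilon>m sub by (metis Pow_iff inj_on_image_eq_iff subsetD)
    moreover have "?\<epsilon> ` m = m \<or> ?\<epsilon> ` m \<inter> m = {}"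
      using d(2) im inj \<epsilon>m mP by (metis image_Int_subset image_is_empty inj_on_image_eq_iff subset_empty)
    ultimately show ?thesis using m' by blast
  qed
  then show ?thesis using bij by (simp add: dilatation_def)
qed

lemma dilatable_pullback:
  assumes f: "bij_betw f P Q" and M: "M = (`) f ` \<Lambda>" and sub: "\<Lambda> \<subseteq> Pow P" and dil: "dilatable Q M"
  shows "dilatable P \<Lambda>"
  unfolding dilatable_def
proof (intro ballI impI)
  fix l c a b assume l: "l \<in> \<Lambda>" "c \<in> l" "a \<in> l" "b \<in> l" "a \<noteq> c" "b \<noteq> c"
  then have P: "c \<in> P" "a \<in> P" "b \<in> P" using sub by auto
  have inj: "inj_on f P" using f by (auto simp: bij_betw_def)
  have "f ` l \<in> M" "f a \<noteq> f c" "f b \<noteq> f c"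
    using l M P inj by (auto simp: inj_on_def)
  moreover have "f c \<in> f ` l" "f a \<in> f ` l" "f b \<in> f ` l" using l by auto
  ultimately obtain \<delta> where \<delta>: "dilatation Q M \<delta>" "\<delta> (f c) = f c" "\<delta> (f a) = f b"
    using dil unfolding dilatable_def by meson
  have "dilatation P \<Lambda> (inv_into P f \<circ> \<delta> \<circ> f)"
    by (rule dilatation_pullback[OF f M sub \<delta>(1)])
  moreover have "(inv_into P f \<circ> \<delta> \<circ> f) c = c" "(inv_into P f \<circ> \<delta> \<circ> f) a = b"
    using \<delta> P inj by auto
  ultimately show "\<exists>\<delta>. dilatation P \<Lambda> \<delta> \<and> \<delta> c = c \<and> \<delta> a = b" by blast
qed

section \<open>The linear space of a partition of an abelian group\<close>

text \<open>
  The set \<open>part z\<close> is the subgroup through \<open>z\<close> in a partition of the finite group \<open>F\<close> into subgroups of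
  order \<open>m\<close> that pairwise share only \<open>0\<close>. Values of \<open>part\<close> at \<open>0\<close> and outside \<open>F\<close> are arbitrary. The
  cosets of these subgroups are the lines of a translation structure in the sense of Andre.
\<close>

locale additive_partition =
  fixes F :: "'a::ab_group_add set" and part :: "'a \<Rightarrow> 'a set" and m :: nat
  assumes finite_F: "finite F" and zero_F: "0 \<in> F" and diff_F: "\<lbrakk>x \<in> F; y \<in> F\<rbrakk> \<Longrightarrow> x - y \<in> F"
    and part_subset: "\<lbrakk>z \<in> F; z \<noteq> 0\<rbrakk> \<Longrightarrow> part z \<subseteq> F"
    and part_self: "\<lbrakk>z \<in> F; z \<noteq> 0\<rbrakk> \<Longrightarrow> z \<in> part z"
    and part_diff: "\<lbrakk>z \<in> F; z \<noteq> 0; x \<in> part z; y \<in> part z\<rbrakk> \<Longrightarrow> x - y \<in> part z"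
    and part_eq: "\<lbrakk>z \<in> F; z \<noteq> 0; y \<in> part z; y \<noteq> 0\<rbrakk> \<Longrightarrow> part y = part z"
    and card_part: "\<lbrakk>z \<in> F; z \<noteq> 0\<rbrakk> \<Longrightarrow> card (part z) = m"
    and part_proper: "\<lbrakk>z \<in> F; z \<noteq> 0\<rbrakk> \<Longrightarrow> part z \<noteq> F"
begin

definition coset_lines :: "'a set set" where
  "coset_lines = {(+) v ` part z | v z. v \<in> F \<and> z \<in> F \<and> z \<noteq> 0}"

lemma uminus_F: "x \<in> F \<Longrightarrow> - x \<in> F"
  using diff_F[OF zero_F] by simp

lemma add_F: "x \<in> F \<Longrightarrow> y \<in> F \<Longrightarrow> x + y \<in> F"
  using diff_F[of x "- y"] uminus_F by simp

lemma part_zero: "\<lbrakk>z \<in> F; z \<noteq> 0\<rbrakk> \<Longrightarrow> 0 \<in> part z"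
  using part_diff[of z z z] part_self by simp

lemma part_uminus: "\<lbrakk>z \<in> F; z \<noteq> 0; x \<in> part z\<rbrakk> \<Longrightarrow> - x \<in> part z"
  using part_diff[of z 0 x] part_zero by simp

lemma part_add: "\<lbrakk>z \<in> F; z \<noteq> 0; x \<in> part z; y \<in> part z\<rbrakk> \<Longrightarrow> x + y \<in> part z"
  using part_diff[of z x "- y"] part_uminus by simp

lemma parts_meet_trivially:
  assumes "u \<in> F" "u \<noteq> 0" "v \<in> F" "v \<noteq> 0" "v \<notin> part u" "x \<in> part u" "x \<in> part v"
  shows "x = 0"
proof (rule ccontr)
  assume "x \<noteq> 0"
  then have "part u = part v" using part_eq[of u x] part_eq[of v x] assms by simp
  then show False using part_self[of v] assms by simp
qed

lemma coset_shift:
  assumes "z \<in> F" "z \<noteq> 0" "x - v \<in> part z"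
  shows "(+) x ` part z = (+) v ` part z"
proof -
  have "(+) x ` part z \<subseteq> (+) v ` part z" if "x - v \<in> part z" for x v
  proof
    fix y assume "y \<in> (+) x ` part z"
    then obtain w where "w \<in> part z" "y = x + w" by blast
    then have "y = v + ((x - v) + w)" "(x - v) + w \<in> part z"
      using part_add[OF assms(1,2) that] by auto
    then show "y \<in> (+) v ` part z" by blast
  qed
  from this[of x v] this[of v x] show ?thesis
    using assms part_uminus[of z "x - v"] by auto
qed

lemma coset_line_subset: "l \<in> coset_lines \<Longrightarrow> l \<subseteq> F"
  using part_subset add_F by (fastforce simp: coset_lines_def)

lemma coset_line_at:
  assumes "l \<in> coset_lines" "x \<in> l"
  obtains z where "z \<in> F" "z \<noteq> 0" "l = (+) x ` part z"
proof -
  obtain v z where l: "l = (+) v ` part z" "z \<in> F" "z \<noteq> 0"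
    using assms by (auto simp: coset_lines_def)
  then have "x - v \<in> part z" using assms by auto
  then show ?thesis using that[of z] l coset_shift by auto
qed

lemma coset_line_through:
  assumes "l \<in> coset_lines" "x \<in> l" "y \<in> l" "x \<noteq> y"
  shows "l = (+) x ` part (y - x)"
proof -
  obtain z where z: "z \<in> F" "z \<noteq> 0" "l = (+) x ` part z"
    using coset_line_at assms by metis
  then have "y - x \<in> part z" using assms by auto
  then have "part (y - x) = part z" using part_eq z assms by auto
  then show ?thesis using z by simp
qed

lemma coset_lineI: "v \<in> F \<Longrightarrow> z \<in> F \<Longrightarrow> z \<noteq> 0 \<Longrightarrow> (+) v ` part z \<in> coset_lines"
  by (auto simp: coset_lines_def)

lemma part_line: "z \<in> F \<Longrightarrow> z \<noteq> 0 \<Longrightarrow> part z \<in> coset_lines"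
  using coset_lineI[OF zero_F, of z] by (simp add: image_def)

lemma card_coset_line: "l \<in> coset_lines \<Longrightarrow> card l = m"
  using card_part by (auto simp: coset_lines_def card_image)

text \<open>
  The line joining \<open>x\<close> and \<open>y\<close> is the coset of \<open>part (y - x)\<close> through \<open>x\<close>. A quadrangle is given by \<open>0\<close>,
  \<open>a\<close>, \<open>b\<close>, \<open>a + b\<close> for elements \<open>a\<close> and \<open>b\<close> of different parts.
\<close>

lemma linear_space_cosets:
  assumes F: "F \<noteq> {0}" and m: "m > 2"
  shows "linear_space (set_space F coset_lines)"
proof -
  obtain a where a: "a \<in> F" "a \<noteq> 0"
    using F zero_F by blast
  obtain b where b: "b \<in> F" "b \<notin> part a"
    using part_subset part_proper a by blast
  have b0: "b \<noteq> 0" using b part_zero a by auto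
  have ab: "part a \<noteq> part b" using b b0 part_self by auto
  have a_b: "a \<notin> part b" using ab part_eq a b b0 by blast
  show ?thesis
  proof
    show "finite (points (set_space F coset_lines))" using finite_F by simp
  next
    fix x y assume xy: "x \<in> points (set_space F coset_lines)" "y \<in> points (set_space F coset_lines)" "x \<noteq> y"
    then have "(+) x ` part (y - x) \<in> coset_lines" "x \<in> (+) x ` part (y - x)" "y \<in> (+) x ` part (y - x)"
      using diff_F[of y x] by (auto intro!: coset_lineI image_eqI[of x _ 0] image_eqI[of y _ "y - x"] part_zero part_self)
    moreover have "l = (+) x ` part (y - x)" if "l \<in> coset_lines" "x \<in> l" "y \<in> l" for l
      by (rule coset_line_through[OF that xy(3)])
    ultimately have "\<exists>!l. l \<in> coset_lines \<and> x \<in> l \<and> y \<in> l"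
      by metis
    then show "\<exists>!l. l \<in> lines (set_space F coset_lines) \<and> inc (set_space F coset_lines) x l \<and>
        inc (set_space F coset_lines) y l"
      by simp
  next
    fix x assume x: "x \<in> points (set_space F coset_lines)"
    have "(+) x ` part a \<noteq> (+) x ` part b"
      using ab by (simp add: inj_image_eq_iff)
    then show "\<exists>l l'. l \<in> lines (set_space F coset_lines) \<and> l' \<in> lines (set_space F coset_lines) \<and>
        l \<noteq> l' \<and> inc (set_space F coset_lines) x l \<and> inc (set_space F coset_lines) x l'"
      using x a b b0 part_zero
      by (intro exI[of _ "(+) x ` part a"] exI[of _ "(+) x ` part b"]) (auto intro!: coset_lineI image_eqI[of x _ 0])
  next
    fix l assume "l \<in> lines (set_space F coset_lines)"
    then obtain v z where "v \<in> F" "z \<in> F" "z \<noteq> 0" "l = (+) v ` part z"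
      by (auto simp: coset_lines_def)
    then show "\<exists>x y. x \<in> points (set_space F coset_lines) \<and> y \<in> points (set_space F coset_lines) \<and> x \<noteq> y \<and>
        inc (set_space F coset_lines) x l \<and> inc (set_space F coset_lines) y l"
      using part_zero part_self add_F
      by (intro exI[of _ v] exI[of _ "v + z"]) (auto intro!: image_eqI[of v _ 0])
  next
    have "{x \<in> F. x \<in> part a} = part a" using part_subset a by blast
    then show "\<exists>l\<in>lines (set_space F coset_lines).
        card {x \<in> points (set_space F coset_lines). inc (set_space F coset_lines) x l} > 2"
      using part_line a card_part m by (intro bexI[of _ "part a"]) auto
  next
    define S where "S = {0, a, b, a + b}"
    have apb: "a + b \<notin> part a" "a + b \<notin> part b"
      using part_diff[of a "a + b" a] part_diff[of b "a + b" b] part_self a b b0 a_b by auto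
    have card: "card S = 4"
      using a b b0 apb part_zero part_self unfolding S_def by (auto simp: card_insert_if)
    have nc1: "\<not> {0, a, b} \<subseteq> l" if "l \<in> coset_lines" for l
      using coset_line_through[OF that, of 0 a] a b by auto
    have nc2: "\<not> {0, a, a + b} \<subseteq> l" if "l \<in> coset_lines" for l
      using coset_line_through[OF that, of 0 a] a apb by auto
    have nc3: "\<not> {0, b, a + b} \<subseteq> l" if "l \<in> coset_lines" for l
      using coset_line_through[OF that, of 0 b] b0 apb by auto
    have nc4: "\<not> {a, b, a + b} \<subseteq> l" if "l \<in> coset_lines" for l
    proof
      assume sub: "{a, b, a + b} \<subseteq> l"
      then have "l = (+) a ` part b"
        using coset_line_through[OF that, of a "a + b"] b0 by auto
      then have "b - a \<in> part b" using sub by auto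
      then show False using part_diff[of b b "b - a"] part_self a_b b b0 by simp
    qed
    have "\<not> collinear (set_space F coset_lines) T" if T: "T \<subseteq> S" "card T = 3" for T
    proof
      assume "collinear (set_space F coset_lines) T"
      then obtain l where l: "l \<in> coset_lines" "T \<subseteq> l"
        by (auto simp: collinear_def)
      have "finite S" by (simp add: S_def)
      then have "card (S - T) = 1"
        using T card by (simp add: card_Diff_subset finite_subset)
      then obtain t where "S - T = {t}" by (meson card_1_singletonE)
      then have "t \<in> S" "S - {t} \<subseteq> l" using T l by auto
      then have t: "t \<in> {0, a, b, a + b}" "{0, a, b, a + b} - {t} \<subseteq> l"
        by (simp_all only: S_def)
      have "distinct [0, a, b, a + b]"
        using card by (intro card_distinct) (simp add: S_def)
      then have sub: "{a, b, a + b} \<subseteq> {0, a, b, a + b} - {0}" "{0, b, a + b} \<subseteq> {0, a, b, a + b} - {a}"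
        "{0, a, a + b} \<subseteq> {0, a, b, a + b} - {b}" "{0, a, b} \<subseteq> {0, a, b, a + b} - {a + b}"
        by auto
      consider "t = 0" | "t = a" | "t = b" | "t = a + b" using t(1) by blast
      then show False
      proof cases
        case 1
        then show ?thesis using nc4[OF l(1)] order_trans[OF sub(1)] t(2) by simp
      next
        case 2
        then show ?thesis using nc3[OF l(1)] order_trans[OF sub(2)] t(2) by simp
      next
        case 3
        then show ?thesis using nc2[OF l(1)] order_trans[OF sub(3)] t(2) by simp
      next
        case 4
        then show ?thesis using nc1[OF l(1)] order_trans[OF sub(4)] t(2) by simp
      qed
    qed
    then show "\<exists>S\<subseteq>points (set_space F coset_lines). card S = 4 \<and>
        (\<forall>T\<subseteq>S. card T = 3 \<longrightarrow> \<not> collinear (set_space F coset_lines) T)"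
      using card a b zero_F add_F by (intro exI[of _ S]) (auto simp: S_def)
  qed
qed

text \<open>
  The line \<open>part z\<close> and its image share the point \<open>0\<close>, so they are not disjoint.
\<close>

lemma central_dilatation_preserves_part:
  assumes \<delta>: "dilatation F coset_lines \<delta>" "\<delta> 0 = 0" and z: "z \<in> F" "z \<noteq> 0"
  shows "\<delta> ` part z = part z"
proof -
  have "0 \<in> \<delta> ` part z \<inter> part z"
    using part_zero[OF z] \<delta>(2) by force
  then show ?thesis
    using \<delta>(1) part_line[OF z] unfolding dilatation_def by blast
qed

text \<open>
  In exponent 3 the line through \<open>x\<close> and \<open>y\<close> contains \<open>x - (y - x) = - (x + y)\<close>, so a set \<open>W\<close> that contains
  \<open>0\<close> and is closed under joining points is a subgroup, and it contains the part of each of its points.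
  The sum of two distinct parts already has \<open>m\<^sup>2\<close> elements.
\<close>

lemma planar_subset_is_sum_of_parts:
  assumes exp3: "\<And>x. x \<in> F \<Longrightarrow> x + x + x = 0"
    and W: "W \<subseteq> F" "0 \<in> W" "card W \<le> m\<^sup>2"
    and cl: "\<And>l x y. l \<in> coset_lines \<Longrightarrow> x \<in> W \<inter> l \<Longrightarrow> y \<in> W \<inter> l \<Longrightarrow> x \<noteq> y \<Longrightarrow> l \<subseteq> W"
    and uv: "u \<in> W" "u \<noteq> 0" "v \<in> W" "v \<noteq> 0" "v \<notin> part u"
  shows "W = (\<lambda>(a, b). a + b) ` (part u \<times> part v)"
proof -
  have part_W: "part x \<subseteq> W" if "x \<in> W" "x \<noteq> 0" for x
    using cl[of "part x" 0 x] part_line part_self part_zero that W by auto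
  have neg_W: "- x \<in> W" if "x \<in> W" for x
    using part_W[of x] part_uminus[of x x] part_self[of x] W that by (cases "x = 0") auto
  have add_W: "x + y \<in> W" if xy: "x \<in> W" "y \<in> W" for x y
  proof (cases "x = y")
    case True
    have "x + x = - x" using exp3[of x] W xy by (metis add_eq_0_iff2 subsetD)
    then show ?thesis using neg_W xy True by simp
  next
    case False
    have F: "x \<in> F" "y \<in> F" using xy W by auto
    have d: "y - x \<in> F" "y - x \<noteq> 0" using False F diff_F by auto
    have "(+) x ` part (y - x) \<subseteq> W"
      using False F d xy part_zero[OF d] part_self[OF d]
      by (intro cl[of _ x y]) (auto intro!: coset_lineI image_eqI[of x _ 0] image_eqI[of y _ "y - x"])
    then have "x + - (y - x) \<in> W" using part_uminus[OF d part_self[OF d]] by auto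
    moreover have "x + - (y - x) = - (x + y)"
      using exp3[of x] F by (simp add: algebra_simps add_eq_0_iff2)
    ultimately have "- (x + y) \<in> W" by metis
    then show ?thesis using neg_W[of "- (x + y)"] by (simp only: minus_minus)
  qed
  have F: "u \<in> F" "v \<in> F" using uv W by auto
  have sub: "(\<lambda>(a, b). a + b) ` (part u \<times> part v) \<subseteq> W"
    using add_W part_W[OF uv(1,2)] part_W[OF uv(3,4)] by auto
  have "inj_on (\<lambda>(a, b). a + b) (part u \<times> part v)"
  proof (rule inj_onI, clarify)
    fix a b a' b' assume h: "a \<in> part u" "b \<in> part v" "a' \<in> part u" "b' \<in> part v" "a + b = a' + b'"
    then have e: "a - a' = b' - b" by (simp add: algebra_simps)
    then have in_both: "a - a' \<in> part u" "a - a' \<in> part v"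
      using part_diff[of u a a'] part_diff[of v b' b] h F uv by simp_all
    have "a - a' = 0"
      using parts_meet_trivially[OF F(1) uv(2) F(2) uv(4,5) in_both] .
    then show "a = a' \<and> b = b'" using e by auto
  qed
  then have "card ((\<lambda>(a, b). a + b) ` (part u \<times> part v)) = m\<^sup>2"
    using card_part F uv by (simp add: card_image card_cartesian_product power2_eq_square)
  moreover have "finite W" using W finite_F finite_subset by blast
  ultimately show ?thesis using sub W(3) by (metis card_seteq)
qed

text \<open>
  For \<open>x\<close> and \<open>y\<close> in different parts, \<open>x + y\<close> is the only point on both of the lines \<open>x + part y\<close> and
  \<open>y + part x\<close>. The planes show that \<open>\<delta>\<close> maps these lines to parallel ones, namely to \<open>\<delta> x + part y\<close>
  and \<open>\<delta> y + part x\<close>, whose only common point is \<open>\<delta> x + \<delta> y\<close>. The case of \<open>x\<close> and \<open>y\<close> in the same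
  part follows by adding an element of another part.
\<close>

lemma dilatation_additive:
  assumes exp3: "\<And>x. x \<in> F \<Longrightarrow> x + x + x = 0" and planar: "planar F coset_lines (m\<^sup>2)"
    and \<delta>: "dilatation F coset_lines \<delta>" "\<delta> 0 = 0"
    and xy: "x \<in> F" "y \<in> F"
  shows "\<delta> (x + y) = \<delta> x + \<delta> y"
proof -
  have \<delta>_part: "\<delta> z \<in> part z" if "z \<in> F" "z \<noteq> 0" for z
    using central_dilatation_preserves_part[OF \<delta> that] imageI[OF part_self[OF that], of \<delta>] by simp
  have coset: "\<delta> (x + y) - \<delta> x \<in> part y"
    if x: "x \<in> F" "x \<noteq> 0" and y: "y \<in> F" "y \<noteq> 0" and ni: "y \<notin> part x" for x y
  proof -
    obtain W where W: "W \<subseteq> F" "{0, x, y} \<subseteq> W" "card W \<le> m\<^sup>2"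
      and cl': "\<forall>l\<in>coset_lines. \<forall>x\<in>W \<inter> l. \<forall>y\<in>W \<inter> l. x \<noteq> y \<longrightarrow> l \<subseteq> W"
      using planar[unfolded planar_def, rule_format, OF zero_F x(1) y(1)] by blast
    have cl: "l \<subseteq> W" if "l \<in> coset_lines" "x \<in> W \<inter> l" "y \<in> W \<inter> l" "x \<noteq> y" for l x y
      using cl' that by blast
    have W_sum: "W = (\<lambda>(a, b). a + b) ` (part u \<times> part v)"
      if "u \<in> W" "u \<noteq> 0" "v \<in> W" "v \<noteq> 0" "v \<notin> part u" for u v
      using planar_subset_is_sum_of_parts[OF exp3 W(1) _ W(3) cl that] W by auto
    have Wxy: "W = (\<lambda>(a, b). a + b) ` (part x \<times> part y)"
      using W_sum W x y ni by auto
    have \<delta>W: "\<delta> w \<in> W" if "w \<in> W" for w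
    proof (cases "w = 0")
      case False
      then have "part w \<subseteq> W"
        using cl[of "part w" 0 w] that W part_line part_self part_zero by auto
      then show ?thesis using \<delta>_part[of w] that W False by auto
    qed (use \<delta> W in auto)
    define l where "l = (+) x ` part y"
    have l: "l \<in> coset_lines" using coset_lineI x y l_def by simp
    have lW: "l \<subseteq> W" unfolding l_def Wxy using part_self x by auto
    have \<delta>l: "\<delta> ` l \<in> coset_lines" "\<delta> ` l = l \<or> \<delta> ` l \<inter> l = {}"
      using \<delta> l by (auto simp: dilatation_def)
    have xl: "x \<in> l" "x + y \<in> l"
      using part_zero part_self y by (auto simp: l_def intro!: image_eqI[of x _ 0])
    obtain z where z: "z \<in> F" "z \<noteq> 0" "\<delta> ` l = (+) (\<delta> x) ` part z"
      using coset_line_at[OF \<delta>l(1)] xl by blast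
    have "part z = part y"
    proof (cases "z \<in> part y")
      case True
      then show ?thesis using part_eq y z by blast
    next
      case False
      \<comment> \<open>The line and its image have different directions in the plane \<open>W\<close>, so they meet. Hence they
          coincide, which is absurd.\<close>
      have in_W: "\<delta> x - x \<in> W"
      proof -
        have "\<delta> x - x \<in> part x" using \<delta>_part x part_diff part_self by blast
        then show ?thesis unfolding Wxy using part_zero y by (force intro!: image_eqI[of _ _ "(\<delta> x - x, 0)"])
      qed
      have "\<delta> x + z \<in> \<delta> ` l"
        unfolding z(3) using part_self z by blast
      then obtain w where "w \<in> l" "\<delta> x + z = \<delta> w" by blast
      then have "\<delta> x + z \<in> W"
        using \<delta>W lW by auto
      then obtain a b where ab: "\<delta> x + z = a + b" "a \<in> part x" "b \<in> part y"
        unfolding Wxy by auto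
      have "z = (a - \<delta> x) + b" using ab by (simp add: algebra_simps)
      moreover have "a - \<delta> x \<in> part x" using ab \<delta>_part x part_diff by blast
      ultimately have "z \<in> W" unfolding Wxy using ab by blast
      then have "W = (\<lambda>(a, b). a + b) ` (part y \<times> part z)"
        using W_sum[of y z] W y z False by auto
      then obtain c d where cd: "\<delta> x - x = c + d" "c \<in> part y" "d \<in> part z"
        using in_W by auto
      have "x + c = \<delta> x + - d" using cd by (simp add: algebra_simps)
      moreover have "- d \<in> part z" using cd part_uminus z by blast
      ultimately have "x + c \<in> \<delta> ` l" unfolding z(3) by blast
      moreover have "x + c \<in> l" using cd unfolding l_def by blast
      ultimately have "\<delta> ` l = l" using \<delta>l by blast
      then have "\<delta> x \<in> l" "\<delta> x + z \<in> l"
        using xl \<open>\<delta> x + z \<in> \<delta> ` l\<close> by blast+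
      then have "\<delta> x - x \<in> part y" "\<delta> x + z - x \<in> part y"
        by (auto simp: l_def)
      then have "z \<in> part y"
        using part_diff[of y "\<delta> x + z - x" "\<delta> x - x"] y by simp
      then show ?thesis using False by simp
    qed
    moreover have "\<delta> (x + y) \<in> (+) (\<delta> x) ` part z"
      using imageI[OF xl(2), of \<delta>] unfolding z(3) .
    ultimately obtain w where "w \<in> part y" "\<delta> (x + y) = \<delta> x + w" by auto
    then show ?thesis by simp
  qed
  have indep: "\<delta> (x + y) = \<delta> x + \<delta> y"
    if x: "x \<in> F" "x \<noteq> 0" and y: "y \<in> F" "y \<noteq> 0" and ni: "y \<notin> part x" for x y
  proof -
    have ni': "x \<notin> part y" using part_eq[OF y _ x(2)] part_self[OF y] ni by auto
    have "\<delta> (x + y) - \<delta> x - \<delta> y \<in> part y"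
      using coset[OF x y ni] \<delta>_part part_diff y by blast
    moreover have "\<delta> (x + y) - \<delta> y - \<delta> x \<in> part x"
      using coset[OF y x ni'] \<delta>_part part_diff x by (metis add.commute)
    ultimately have "\<delta> (x + y) - \<delta> x - \<delta> y \<in> part x \<inter> part y"
      by (simp add: algebra_simps)
    then have "\<delta> (x + y) - \<delta> x - \<delta> y = 0"
      using parts_meet_trivially[OF x y ni] by blast
    then show ?thesis by (simp add: algebra_simps)
  qed
  show ?thesis
  proof (cases "x = 0 \<or> y = 0 \<or> y \<notin> part x")
    case True
    then consider "x = 0" | "y = 0" | "x \<noteq> 0" "y \<noteq> 0" "y \<notin> part x" by blast
    then show ?thesis
    proof cases
      case 3
      then show ?thesis by (rule indep[OF xy(1) _ xy(2)])
    qed (simp_all add: \<delta>)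
  next
    case False
    then have x: "x \<in> F" "x \<noteq> 0" and y: "y \<in> F" "y \<noteq> 0" and yx: "y \<in> part x" using xy by auto
    \<comment> \<open>Both \<open>x\<close> and \<open>y\<close> lie in the same part; \<open>z\<close> is used to leave it.\<close>
    obtain z where z: "z \<in> F" "z \<notin> part x"
      using part_subset part_proper x by blast
    have z0: "z \<noteq> 0" using z part_zero x by auto
    have pyx: "part y = part x" using part_eq x y yx by blast
    have "y + z \<notin> part x"
      using part_diff[of x "y + z" y] yx x z by auto
    moreover have "y + z \<noteq> 0" using calculation part_zero[OF x] by auto
    ultimately have "\<delta> (x + (y + z)) = \<delta> x + \<delta> (y + z)"
      using indep[OF x add_F[OF y(1) z(1)]] by simp
    also have "\<delta> (y + z) = \<delta> y + \<delta> z"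
      using indep[OF y z(1) z0] z(2) pyx by simp
    finally have "\<delta> ((x + y) + z) = \<delta> x + \<delta> y + \<delta> z" by (simp add: algebra_simps)
    moreover have "\<delta> ((x + y) + z) = \<delta> (x + y) + \<delta> z"
    proof (cases "x + y = 0")
      case False
      have "part (x + y) = part x"
        using part_eq[OF x part_add[OF x part_self[OF x] yx] False] .
      then show ?thesis using indep[of "x + y" z] x y z z0 False add_F by auto
    qed (use \<delta> in simp)
    ultimately show ?thesis by simp
  qed
qed

end

section \<open>Planes and dilatations of Desarguesian affine spaces\<close>

context field
begin

lemma inv_nonzero:
  assumes "r \<in> carrier R" "r \<noteq> \<zero>"
  shows "inv r \<in> carrier R" "r \<otimes> inv r = \<one>"
  using assms Units_inv_closed[of r] Units_r_inv[of r] field_Units by blast+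

lemma dilate_undilate:
  assumes "u \<in> carrier R" "x \<in> carrier R" "r \<in> carrier R" "i \<in> carrier R" "r \<otimes> i = \<one>"
  shows "u \<oplus> r \<otimes> ((u \<oplus> i \<otimes> (x \<ominus> u)) \<ominus> u) = x"
proof -
  have "u \<oplus> r \<otimes> ((u \<oplus> i \<otimes> (x \<ominus> u)) \<ominus> u) = u \<oplus> (r \<otimes> i) \<otimes> (x \<ominus> u)"
    using assms(1-4) by algebra
  also have "\<dots> = x"
    unfolding assms(5) using assms(1,2) by algebra
  finally show ?thesis .
qed

text \<open>
  One coordinate of the fact that a line is parametrised affinely by any two of its points. The
  element \<open>i\<close> stands for the inverse of \<open>c' \<ominus> c\<close>, which leaves a polynomial identity.
\<close>

lemma line_point_from_two_points:
  assumes "v \<in> carrier R" "w \<in> carrier R" "c \<in> carrier R" "c' \<in> carrier R" "d \<in> carrier R" "i \<in> carrier R"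
    and i: "(c' \<ominus> c) \<otimes> i = \<one>"
  shows "v \<oplus> d \<otimes> w = (v \<oplus> c \<otimes> w) \<oplus> ((d \<ominus> c) \<otimes> i) \<otimes> ((v \<oplus> c' \<otimes> w) \<ominus> (v \<oplus> c \<otimes> w))"
proof -
  have "(v \<oplus> c \<otimes> w) \<oplus> ((d \<ominus> c) \<otimes> i) \<otimes> ((v \<oplus> c' \<otimes> w) \<ominus> (v \<oplus> c \<otimes> w)) =
      (v \<oplus> c \<otimes> w) \<oplus> ((c' \<ominus> c) \<otimes> i) \<otimes> ((d \<ominus> c) \<otimes> w)"
    using assms(1-6) by algebra
  also have "\<dots> = v \<oplus> d \<otimes> w"
    unfolding i using assms(1-6) by algebra
  finally show ?thesis ..
qed

text \<open>
  One coordinate of the fact that the points \<open>v + s a + t b\<close> contain the line through any two of them.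
\<close>

lemma plane_point_on_line:
  assumes "v \<in> carrier R" "a \<in> carrier R" "b \<in> carrier R" "s \<in> carrier R" "t \<in> carrier R"
    "s' \<in> carrier R" "t' \<in> carrier R" "r \<in> carrier R"
  shows "(v \<oplus> s \<otimes> a \<oplus> t \<otimes> b) \<oplus> r \<otimes> ((v \<oplus> s' \<otimes> a \<oplus> t' \<otimes> b) \<ominus> (v \<oplus> s \<otimes> a \<oplus> t \<otimes> b)) =
    v \<oplus> (s \<oplus> r \<otimes> (s' \<ominus> s)) \<otimes> a \<oplus> (t \<oplus> r \<otimes> (t' \<ominus> t)) \<otimes> b"
  using assms by algebra

definition ag_line :: "'a \<times> 'a \<times> 'a \<Rightarrow> 'a \<times> 'a \<times> 'a \<Rightarrow> ('a \<times> 'a \<times> 'a) set" where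
  "ag_line = (\<lambda>(v1, v2, v3) (w1, w2, w3). (\<lambda>c. (v1 \<oplus> c \<otimes> w1, v2 \<oplus> c \<otimes> w2, v3 \<oplus> c \<otimes> w3)) ` carrier R)"

lemma vec3_carrier_iff: "(x, y, z) \<in> vec3_carrier R \<longleftrightarrow> x \<in> carrier R \<and> y \<in> carrier R \<and> z \<in> carrier R"
  by (simp add: vec3_carrier_def)

lemma lines_desarguesian:
  "lines (desarguesian_affine_space R) =
    {ag_line v w | v w. v \<in> vec3_carrier R \<and> w \<in> vec3_carrier R - {(\<zero>, \<zero>, \<zero>)}}"
proof -
  have coset: "vec3_add R v ` {vec3_smult R c w | c. c \<in> carrier R} = ag_line v w" for v w :: "'a \<times> 'a \<times> 'a"
    by (cases v; cases w) (simp add: ag_line_def Setcompr_eq_image image_image)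
  have "lines (desarguesian_affine_space R) = {vec3_add R v ` {vec3_smult R c w | c. c \<in> carrier R} | v w.
      v \<in> vec3_carrier R \<and> w \<in> vec3_carrier R - {(\<zero>, \<zero>, \<zero>)}}"
    unfolding desarguesian_affine_space_def one_dim_subspaces_def incidence_structure.simps by blast
  then show ?thesis
    unfolding coset .
qed

lemma desarguesian_lines_subset: "lines (desarguesian_affine_space R) \<subseteq> Pow (vec3_carrier R)"
  unfolding lines_desarguesian by (auto simp: ag_line_def vec3_carrier_def)

lemma planar_desarguesian:
  assumes fin: "finite (carrier R)"
  shows "planar (vec3_carrier R) (lines (desarguesian_affine_space R)) ((card (carrier R))\<^sup>2)"
  unfolding planar_def
proof (intro ballI)
  fix v a b assume "v \<in> vec3_carrier R" "a \<in> vec3_carrier R" "b \<in> vec3_carrier R"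
  moreover obtain v1 v2 v3 where v: "v = (v1, v2, v3)" by (cases v)
  moreover obtain a1 a2 a3 where a: "a = (a1, a2, a3)" by (cases a)
  moreover obtain b1 b2 b3 where b: "b = (b1, b2, b3)" by (cases b)
  ultimately have cl [simp]: "v1 \<in> carrier R" "v2 \<in> carrier R" "v3 \<in> carrier R" "a1 \<in> carrier R"
    "a2 \<in> carrier R" "a3 \<in> carrier R" "b1 \<in> carrier R" "b2 \<in> carrier R" "b3 \<in> carrier R"
    by (auto simp: vec3_carrier_def)
  define pt where "pt = (\<lambda>(s, t). (v1 \<oplus> s \<otimes> (a1 \<ominus> v1) \<oplus> t \<otimes> (b1 \<ominus> v1),
      v2 \<oplus> s \<otimes> (a2 \<ominus> v2) \<oplus> t \<otimes> (b2 \<ominus> v2), v3 \<oplus> s \<otimes> (a3 \<ominus> v3) \<oplus> t \<otimes> (b3 \<ominus> v3)))"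
  define W where "W = pt ` (carrier R \<times> carrier R)"
  have "W \<subseteq> vec3_carrier R"
    by (auto simp: W_def pt_def vec3_carrier_iff)
  moreover have "v \<in> W" "a \<in> W" "b \<in> W"
  proof -
    have id: "x \<oplus> \<zero> \<otimes> (y \<ominus> x) \<oplus> \<zero> \<otimes> (z \<ominus> x) = x" "x \<oplus> \<one> \<otimes> (y \<ominus> x) \<oplus> \<zero> \<otimes> (z \<ominus> x) = y"
      "x \<oplus> \<zero> \<otimes> (y \<ominus> x) \<oplus> \<one> \<otimes> (z \<ominus> x) = z"
      if "x \<in> carrier R" "y \<in> carrier R" "z \<in> carrier R" for x y z
      using that by algebra+
    have "v = pt (\<zero>, \<zero>)" "a = pt (\<one>, \<zero>)" "b = pt (\<zero>, \<one>)"
      unfolding pt_def v a b by (simp_all only: id cl prod.case)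
    then show "v \<in> W" "a \<in> W" "b \<in> W"
      unfolding W_def by (metis SigmaI imageI zero_closed one_closed)+
  qed
  moreover have "card W \<le> (card (carrier R))\<^sup>2"
  proof -
    have "card W \<le> card (carrier R \<times> carrier R)"
      unfolding W_def using fin by (intro card_image_le) simp
    then show ?thesis by (simp add: card_cartesian_product power2_eq_square)
  qed
  moreover have "l \<subseteq> W" if l: "l \<in> lines (desarguesian_affine_space R)" and x: "x \<in> W \<inter> l" and y: "y \<in> W \<inter> l"
    and ne: "x \<noteq> y" for l x y
  proof
    fix z assume "z \<in> l"
    obtain u1 u2 u3 w1 w2 w3 where l_eq: "l = ag_line (u1, u2, u3) (w1, w2, w3)"
      and uw: "u1 \<in> carrier R" "u2 \<in> carrier R" "u3 \<in> carrier R" "w1 \<in> carrier R" "w2 \<in> carrier R" "w3 \<in> carrier R"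
      using l unfolding lines_desarguesian by (auto simp: vec3_carrier_def)
    obtain c c' d where c: "c \<in> carrier R" "c' \<in> carrier R" "d \<in> carrier R"
      and x_eq: "x = (u1 \<oplus> c \<otimes> w1, u2 \<oplus> c \<otimes> w2, u3 \<oplus> c \<otimes> w3)"
      and y_eq: "y = (u1 \<oplus> c' \<otimes> w1, u2 \<oplus> c' \<otimes> w2, u3 \<oplus> c' \<otimes> w3)"
      and z_eq: "z = (u1 \<oplus> d \<otimes> w1, u2 \<oplus> d \<otimes> w2, u3 \<oplus> d \<otimes> w3)"
      using x y \<open>z \<in> l\<close> unfolding l_eq ag_line_def by auto
    have "c' \<ominus> c \<noteq> \<zero>"
      using ne x_eq y_eq c by (auto simp: r_right_minus_eq)
    then have i: "inv (c' \<ominus> c) \<in> carrier R" "(c' \<ominus> c) \<otimes> inv (c' \<ominus> c) = \<one>"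
      using c by (intro inv_nonzero; simp)+
    define r where "r = (d \<ominus> c) \<otimes> inv (c' \<ominus> c)"
    have r: "r \<in> carrier R" using i c by (simp add: r_def)
    obtain s t s' t' where st: "s \<in> carrier R" "t \<in> carrier R" "s' \<in> carrier R" "t' \<in> carrier R"
      and xp: "x = pt (s, t)" and yp: "y = pt (s', t')"
      using x y unfolding W_def by auto
    have "z = pt (s \<oplus> r \<otimes> (s' \<ominus> s), t \<oplus> r \<otimes> (t' \<ominus> t))"
      unfolding z_eq pt_def prod.case prod.inject
    proof (intro conjI)
      show "u1 \<oplus> d \<otimes> w1 = v1 \<oplus> (s \<oplus> r \<otimes> (s' \<ominus> s)) \<otimes> (a1 \<ominus> v1) \<oplus> (t \<oplus> r \<otimes> (t' \<ominus> t)) \<otimes> (b1 \<ominus> v1)"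
        using xp yp unfolding x_eq y_eq pt_def
        by (subst line_point_from_two_points[of u1 w1 c c' d "inv (c' \<ominus> c)"])
          (simp_all add: uw c i st r plane_point_on_line flip: r_def)
      show "u2 \<oplus> d \<otimes> w2 = v2 \<oplus> (s \<oplus> r \<otimes> (s' \<ominus> s)) \<otimes> (a2 \<ominus> v2) \<oplus> (t \<oplus> r \<otimes> (t' \<ominus> t)) \<otimes> (b2 \<ominus> v2)"
        using xp yp unfolding x_eq y_eq pt_def
        by (subst line_point_from_two_points[of u2 w2 c c' d "inv (c' \<ominus> c)"])
          (simp_all add: uw c i st r plane_point_on_line flip: r_def)
      show "u3 \<oplus> d \<otimes> w3 = v3 \<oplus> (s \<oplus> r \<otimes> (s' \<ominus> s)) \<otimes> (a3 \<ominus> v3) \<oplus> (t \<oplus> r \<otimes> (t' \<ominus> t)) \<otimes> (b3 \<ominus> v3)"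
        using xp yp unfolding x_eq y_eq pt_def
        by (subst line_point_from_two_points[of u3 w3 c c' d "inv (c' \<ominus> c)"])
          (simp_all add: uw c i st r plane_point_on_line flip: r_def)
    qed
    then show "z \<in> W"
      unfolding W_def using st r by auto
  qed
  ultimately show "\<exists>W\<subseteq>vec3_carrier R. {v, a, b} \<subseteq> W \<and> card W \<le> (card (carrier R))\<^sup>2 \<and>
      (\<forall>l\<in>lines (desarguesian_affine_space R). \<forall>x\<in>W \<inter> l. \<forall>y\<in>W \<inter> l. x \<noteq> y \<longrightarrow> l \<subseteq> W)"
    by (intro exI[of _ W]) blast
qed


lemma ag_lines_same_direction:
  assumes "w \<in> vec3_carrier R" "v \<in> vec3_carrier R" "p \<in> vec3_carrier R"
  shows "ag_line p w = ag_line v w \<or> ag_line p w \<inter> ag_line v w = {}"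
proof -
  have sub: "ag_line p w \<subseteq> ag_line v w"
    if V: "v \<in> vec3_carrier R" "p \<in> vec3_carrier R" and x: "x \<in> ag_line p w" "x \<in> ag_line v w" for v p x
  proof
    fix y assume y: "y \<in> ag_line p w"
    obtain v1 v2 v3 where v: "v = (v1, v2, v3)" by (cases v)
    obtain p1 p2 p3 where p: "p = (p1, p2, p3)" by (cases p)
    obtain w1 w2 w3 where w: "w = (w1, w2, w3)" by (cases w)
    note eq = v p w
    have cl: "v1 \<in> carrier R" "v2 \<in> carrier R" "v3 \<in> carrier R" "p1 \<in> carrier R" "p2 \<in> carrier R"
      "p3 \<in> carrier R" "w1 \<in> carrier R" "w2 \<in> carrier R" "w3 \<in> carrier R"
      using V assms(1) unfolding eq by (auto simp: vec3_carrier_def)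
    obtain c d e where c: "c \<in> carrier R" "d \<in> carrier R" "e \<in> carrier R"
      and xp: "x = (p1 \<oplus> c \<otimes> w1, p2 \<oplus> c \<otimes> w2, p3 \<oplus> c \<otimes> w3)"
      and xv: "x = (v1 \<oplus> d \<otimes> w1, v2 \<oplus> d \<otimes> w2, v3 \<oplus> d \<otimes> w3)"
      and yp: "y = (p1 \<oplus> e \<otimes> w1, p2 \<oplus> e \<otimes> w2, p3 \<oplus> e \<otimes> w3)"
      using x y unfolding eq ag_line_def by auto
    have comp: "p' \<oplus> e \<otimes> w' = v' \<oplus> (d \<oplus> (e \<ominus> c)) \<otimes> w'"
      if "p' \<in> carrier R" "v' \<in> carrier R" "w' \<in> carrier R" "p' \<oplus> c \<otimes> w' = v' \<oplus> d \<otimes> w'" for p' v' w'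
    proof -
      have "p' \<oplus> e \<otimes> w' = (p' \<oplus> c \<otimes> w') \<oplus> (e \<ominus> c) \<otimes> w'"
        using that(1-3) c by algebra
      also have "\<dots> = v' \<oplus> (d \<oplus> (e \<ominus> c)) \<otimes> w'"
        unfolding that(4) using that(1-3) c by algebra
      finally show ?thesis .
    qed
    have "y = (v1 \<oplus> (d \<oplus> (e \<ominus> c)) \<otimes> w1, v2 \<oplus> (d \<oplus> (e \<ominus> c)) \<otimes> w2, v3 \<oplus> (d \<oplus> (e \<ominus> c)) \<otimes> w3)"
      using xp xv unfolding yp by (simp add: comp cl)
    then show "y \<in> ag_line v w"
      unfolding eq ag_line_def using c by auto
  qed
  show ?thesis
    using sub[OF assms(2,3)] sub[OF assms(3,2)] by blast
qed

lemma dilatation_desarguesian: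
  assumes v: "v1 \<in> carrier R" "v2 \<in> carrier R" "v3 \<in> carrier R" and r: "r \<in> carrier R" "r \<noteq> \<zero>"
  shows "dilatation (vec3_carrier R) (lines (desarguesian_affine_space R))
    (\<lambda>(x1, x2, x3). (v1 \<oplus> r \<otimes> (x1 \<ominus> v1), v2 \<oplus> r \<otimes> (x2 \<ominus> v2), v3 \<oplus> r \<otimes> (x3 \<ominus> v3)))"
    (is "dilatation _ _ ?\<delta>")
proof -
  have i: "inv r \<in> carrier R" "r \<otimes> inv r = \<one>"
    by (rule inv_nonzero[OF r])+
  then have i': "inv r \<otimes> r = \<one>" using r(1) by (simp add: m_comm)
  note inverse = dilate_undilate[OF _ _ r(1) i] dilate_undilate[OF _ _ i(1) r(1) i']
  have bij: "bij_betw ?\<delta> (vec3_carrier R) (vec3_carrier R)"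
    by (rule bij_betwI[where g = "\<lambda>(x1, x2, x3).
        (v1 \<oplus> inv r \<otimes> (x1 \<ominus> v1), v2 \<oplus> inv r \<otimes> (x2 \<ominus> v2), v3 \<oplus> inv r \<otimes> (x3 \<ominus> v3))"])
      (auto simp: vec3_carrier_def v r(1) i(1) inverse)
  have "?\<delta> ` l \<in> lines (desarguesian_affine_space R) \<and> (?\<delta> ` l = l \<or> ?\<delta> ` l \<inter> l = {})"
    if l: "l \<in> lines (desarguesian_affine_space R)" for l
  proof -
    obtain u w where uw: "l = ag_line u w" "u \<in> vec3_carrier R" "w \<in> vec3_carrier R" "w \<noteq> (\<zero>, \<zero>, \<zero>)"
      using l unfolding lines_desarguesian by blast
    obtain u1 u2 u3 where u: "u = (u1, u2, u3)" by (cases u)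
    obtain w1 w2 w3 where w: "w = (w1, w2, w3)" by (cases w)
    note eq = u w
    have cl: "u1 \<in> carrier R" "u2 \<in> carrier R" "u3 \<in> carrier R" "w1 \<in> carrier R" "w2 \<in> carrier R"
      "w3 \<in> carrier R"
      using uw unfolding eq by (auto simp: vec3_carrier_def)
    have \<delta>u: "?\<delta> u \<in> vec3_carrier R"
      using bij_betw_apply[OF bij uw(2)] .
    have scale: "(\<otimes>) r ` carrier R = carrier R"
    proof
      show "carrier R \<subseteq> (\<otimes>) r ` carrier R"
      proof
        fix c assume c: "c \<in> carrier R"
        then have "r \<otimes> (inv r \<otimes> c) = (r \<otimes> inv r) \<otimes> c" by (simp only: m_assoc r(1) i(1))
        then have "c = r \<otimes> (inv r \<otimes> c)" using i c by simp
        then show "c \<in> (\<otimes>) r ` carrier R" using c i by blast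
      qed
    qed (use r in auto)
    have move: "v' \<oplus> r \<otimes> ((u' \<oplus> c \<otimes> w') \<ominus> v') = (v' \<oplus> r \<otimes> (u' \<ominus> v')) \<oplus> (r \<otimes> c) \<otimes> w'"
      if "v' \<in> carrier R" "u' \<in> carrier R" "w' \<in> carrier R" "c \<in> carrier R" for u' v' w' c
      using that r(1) by algebra
    have "?\<delta> ` ag_line u w = (\<lambda>c. (v1 \<oplus> r \<otimes> (u1 \<ominus> v1) \<oplus> c \<otimes> w1, v2 \<oplus> r \<otimes> (u2 \<ominus> v2) \<oplus> c \<otimes> w2,
        v3 \<oplus> r \<otimes> (u3 \<ominus> v3) \<oplus> c \<otimes> w3)) ` (\<otimes>) r ` carrier R"
      unfolding eq ag_line_def prod.case image_image
      by (rule image_cong[OF refl]) (simp add: move cl v)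
    then have \<delta>l: "?\<delta> ` l = ag_line (?\<delta> u) w"
      unfolding scale uw(1) by (simp add: eq ag_line_def)
    have "ag_line (?\<delta> u) w \<in> lines (desarguesian_affine_space R)"
      unfolding lines_desarguesian using \<delta>u uw(3,4) by blast
    then show ?thesis
      using ag_lines_same_direction[OF uw(3,2) \<delta>u] unfolding \<delta>l uw(1)[symmetric] by blast
  qed
  then show ?thesis using bij by (simp add: dilatation_def)
qed

lemma dilatable_desarguesian:
  "dilatable (vec3_carrier R) (lines (desarguesian_affine_space R))"
  unfolding dilatable_def
proof (intro ballI impI)
  fix l v a b assume l: "l \<in> lines (desarguesian_affine_space R)" "v \<in> l" "a \<in> l" "b \<in> l"
    and ne: "a \<noteq> v" "b \<noteq> v"
  obtain u1 u2 u3 w1 w2 w3 where l_eq: "l = ag_line (u1, u2, u3) (w1, w2, w3)"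
    and uw: "u1 \<in> carrier R" "u2 \<in> carrier R" "u3 \<in> carrier R" "w1 \<in> carrier R" "w2 \<in> carrier R" "w3 \<in> carrier R"
    using l(1) unfolding lines_desarguesian by (auto simp: vec3_carrier_def)
  obtain c0 c1 c2 where c: "c0 \<in> carrier R" "c1 \<in> carrier R" "c2 \<in> carrier R"
    and eq: "v = (u1 \<oplus> c0 \<otimes> w1, u2 \<oplus> c0 \<otimes> w2, u3 \<oplus> c0 \<otimes> w3)"
     "a = (u1 \<oplus> c1 \<otimes> w1, u2 \<oplus> c1 \<otimes> w2, u3 \<oplus> c1 \<otimes> w3)"
     "b = (u1 \<oplus> c2 \<otimes> w1, u2 \<oplus> c2 \<otimes> w2, u3 \<oplus> c2 \<otimes> w3)"
    using l(2-4) unfolding l_eq ag_line_def prod.case by blast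
  have diff: "c1 \<ominus> c0 \<noteq> \<zero>" "c2 \<ominus> c0 \<noteq> \<zero>"
    using ne c unfolding eq by (auto simp: r_right_minus_eq)
  then have i: "inv (c1 \<ominus> c0) \<in> carrier R" "(c1 \<ominus> c0) \<otimes> inv (c1 \<ominus> c0) = \<one>"
    using c by (intro inv_nonzero; simp)+
  define r where "r = (c2 \<ominus> c0) \<otimes> inv (c1 \<ominus> c0)"
  have r: "r \<in> carrier R" using i c by (simp add: r_def)
  have r_diff: "r \<otimes> (c1 \<ominus> c0) = c2 \<ominus> c0"
    using c i by (simp add: r_def m_assoc m_comm[of "inv (c1 \<ominus> c0)"])
  have r0: "r \<noteq> \<zero>"
  proof
    assume "r = \<zero>"
    then have "c2 \<ominus> c0 = \<zero>" using r_diff c by simp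
    then show False using diff(2) by simp
  qed
  have fix_v: "x \<oplus> r \<otimes> (x \<ominus> x) = x" if "x \<in> carrier R" for x
    using that r by algebra
  have move: "(u \<oplus> c0 \<otimes> w) \<oplus> r \<otimes> ((u \<oplus> c1 \<otimes> w) \<ominus> (u \<oplus> c0 \<otimes> w)) = u \<oplus> c2 \<otimes> w"
    if "u \<in> carrier R" "w \<in> carrier R" for u w
  proof -
    have "(u \<oplus> c0 \<otimes> w) \<oplus> r \<otimes> ((u \<oplus> c1 \<otimes> w) \<ominus> (u \<oplus> c0 \<otimes> w)) = (u \<oplus> c0 \<otimes> w) \<oplus> (r \<otimes> (c1 \<ominus> c0)) \<otimes> w"
      using that c r by algebra
    also have "\<dots> = u \<oplus> c2 \<otimes> w"
      unfolding r_diff using that c by algebra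
    finally show ?thesis .
  qed
  let ?\<delta> = "\<lambda>(x1, x2, x3). ((u1 \<oplus> c0 \<otimes> w1) \<oplus> r \<otimes> (x1 \<ominus> (u1 \<oplus> c0 \<otimes> w1)),
    (u2 \<oplus> c0 \<otimes> w2) \<oplus> r \<otimes> (x2 \<ominus> (u2 \<oplus> c0 \<otimes> w2)), (u3 \<oplus> c0 \<otimes> w3) \<oplus> r \<otimes> (x3 \<ominus> (u3 \<oplus> c0 \<otimes> w3)))"
  have "dilatation (vec3_carrier R) (lines (desarguesian_affine_space R)) ?\<delta>"
    by (rule dilatation_desarguesian) (simp_all add: uw c r r0)
  moreover have "?\<delta> v = v" "?\<delta> a = b"
    unfolding eq by (simp_all add: fix_v move uw c)
  ultimately show "\<exists>\<delta>. dilatation (vec3_carrier R) (lines (desarguesian_affine_space R)) \<delta> \<and> \<delta> v = v \<and> \<delta> a = b"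
    by blast
qed

end

section \<open>Finite fields of characteristic three\<close>

text \<open>
  The polynomial \<open>X ^ p ^ n - X\<close> splits, and it has no multiple root because its derivative is \<open>- 1\<close>.
\<close>

lemma card_frobenius_fixed:
  assumes char: "CHAR('a::alg_closed_field) = p" and p: "Factorial_Ring.prime p" and n: "n > 0"
  shows "card {x::'a. x ^ (p ^ n) = x} = p ^ n"
proof -
  define q where "q = p ^ n"
  have q: "q > 1" unfolding q_def by (rule one_less_power[OF prime_gt_1_nat[OF p] n])
  have of_nat_q: "of_nat q = (0::'a)"
    using char n by (simp add: of_nat_eq_0_iff_char_dvd q_def)
  define P where "P = monom (1::'a) q + [:0, -1:]"
  have deg: "degree P = q"
    unfolding P_def using q by (subst degree_add_eq_left) (auto simp: degree_monom_eq)
  have lead: "lead_coeff P = 1"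
    unfolding deg using q by (simp add: P_def coeff_eq_0)
  have poly_P: "poly P x = x ^ q - x" for x
    by (simp add: P_def poly_monom)
  have pderiv_P: "pderiv P = - 1"
    unfolding P_def using of_nat_q by (simp add: pderiv_add pderiv_monom pderiv_pCons one_pCons)
  have "P \<noteq> 0" using lead by auto
  then obtain A where A: "size A = degree P" "P = Polynomial.smult (lead_coeff P) (\<Prod>x\<in>#A. [:-x, 1:])"
    using alg_closed_imp_factorization by blast
  have P_eq: "P = (\<Prod>x\<in>#A. [:-x, 1:])" using A(2) lead by simp
  have roots: "{x. x ^ q = x} = set_mset A"
  proof -
    have "poly P x = 0 \<longleftrightarrow> x \<in># A" for x
      unfolding P_eq by (induction A) auto
    then show ?thesis by (auto simp: poly_P)
  qed
  have simple: "count A x = 1" if x: "x \<in># A" for x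
  proof (rule ccontr)
    assume "count A x \<noteq> 1"
    obtain B where B: "A = add_mset x B" using x by (metis insert_DiffM)
    have "x \<in># B" using \<open>count A x \<noteq> 1\<close> unfolding B by (simp add: not_in_iff[symmetric])
    then obtain C where C: "B = add_mset x C" by (metis insert_DiffM)
    \<comment> \<open>A double root would be a root of the derivative.\<close>
    have "P = [:-x, 1:] * ([:-x, 1:] * (\<Prod>x\<in>#C. [:-x, 1:]))"
      unfolding P_eq B C by simp
    then have "poly (pderiv P) x = 0" by (simp only: pderiv_mult) simp
    then show False unfolding pderiv_P by simp
  qed
  have "size A = card (set_mset A)"
    by (simp add: size_multiset_overloaded_eq simple)
  then show ?thesis
    using roots A(1) deg q_def by simp
qed

lemma root_exists_minus_one:
  fixes r :: nat
  assumes "r > 1"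
  obtains b :: "'a::alg_closed_field" where "b \<noteq> 0" "b ^ r = - b"
proof -
  obtain b :: 'a where "b ^ (r - 1) = - 1"
    using nth_root_exists[of "r - 1" "- 1 :: 'a"] assms by auto
  moreover from this have "b \<noteq> 0" using assms by (auto simp: power_0_left)
  moreover have "b ^ r = b * b ^ (r - 1)" using assms by (simp add: power_eq_if)
  ultimately show ?thesis using that by simp
qed

lemma artin_schreier_root_exists:
  assumes "r > 1"
  obtains s :: "'a::alg_closed_field" where "s ^ r = s + 1"
proof -
  define P where "P = monom (1::'a) r + [:-1, -1:]"
  have "degree P = r"
    unfolding P_def using assms by (subst degree_add_eq_left) (auto simp: degree_monom_eq)
  then obtain s where "poly P s = 0" using alg_closed_imp_poly_has_root[of P] assms by auto
  then have "s ^ r = s + 1" by (simp add: P_def poly_monom algebra_simps)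
  then show ?thesis by (rule that)
qed

text \<open>
  The field \<open>'a\<close> contains fields \<open>fixed j\<close> with \<open>q ^ j\<close> elements. The element \<open>\<beta>\<close> lies in \<open>fixed 2\<close> but not
  in \<open>fixed 1\<close>, and the Artin-Schreier element \<open>s\<close> lies in \<open>fixed 3\<close> but not in \<open>fixed 1\<close>.
\<close>

locale frobenius_tower =
  fixes q k :: nat and \<beta> s :: "'a::field"
  assumes char: "CHAR('a) = 3" and q_def: "q = 3 ^ k" and k_pos: "k > 0"
    and \<beta>: "\<beta> \<noteq> 0" "\<beta> ^ q = - \<beta>" and s: "s ^ q = s + 1"
    and card_frob: "\<And>j. j > 0 \<Longrightarrow> card {x::'a. x ^ (q ^ j) = x} = q ^ j"
begin

definition fixed :: "nat \<Rightarrow> 'a set" where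
  "fixed j = {x. x ^ (q ^ j) = x}"

lemma card_fixed: "j > 0 \<Longrightarrow> card (fixed j) = q ^ j"
  using card_frob by (simp add: fixed_def)

lemma power_swap: "((x::'a) ^ m) ^ n = (x ^ n) ^ m"
  by (metis power_mult mult.commute)

lemma three_zero: "(3::'a) = 0"
  using of_nat_eq_0_iff_char_dvd[of 3, where ?'a = 'a] char by simp

lemma four_one: "(4::'a) = 1"
proof -
  have "(4::'a) = 3 + 1" by simp
  then show ?thesis by (simp only: three_zero add_0_left)
qed

lemma q_gt_1: "q > 1"
  unfolding q_def by (rule one_less_power[OF _ k_pos]) simp

lemma odd_q: "odd (q ^ j)"
  by (simp add: q_def)

lemma frob_add: "(x + y :: 'a) ^ (q ^ j) = x ^ (q ^ j) + y ^ (q ^ j)"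
  using freshmans_dream'[where ?'a = 'a, of "q ^ j" "k * j" x y] char by (simp add: q_def power_mult)

lemma frob_minus: "(- x :: 'a) ^ (q ^ j) = - (x ^ (q ^ j))"
  using odd_q by (rule power_minus_odd)

lemma frob_diff: "(x - y :: 'a) ^ (q ^ j) = x ^ (q ^ j) - y ^ (q ^ j)"
  using frob_add[of x "- y"] frob_minus[of y] by simp

lemma cube_add: "(x + y :: 'a) ^ 3 = x ^ 3 + y ^ 3"
  by (rule freshmans_dream) (simp_all add: char)

lemma cube_inj: "x ^ 3 = y ^ 3 \<Longrightarrow> x = (y :: 'a)"
  using cube_add[of y "x - y"] by simp

lemma zero_fixed: "0 \<in> fixed j" and one_fixed: "1 \<in> fixed j"
  using q_gt_1 by (simp_all add: fixed_def power_0_left)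

lemma add_fixed: "x \<in> fixed j \<Longrightarrow> y \<in> fixed j \<Longrightarrow> x + y \<in> fixed j"
  by (simp add: fixed_def frob_add)

lemma uminus_fixed: "x \<in> fixed j \<Longrightarrow> - x \<in> fixed j"
  by (simp add: fixed_def frob_minus)

lemma diff_fixed: "x \<in> fixed j \<Longrightarrow> y \<in> fixed j \<Longrightarrow> x - y \<in> fixed j"
  by (simp add: fixed_def frob_diff)

lemma mult_fixed: "x \<in> fixed j \<Longrightarrow> y \<in> fixed j \<Longrightarrow> x * y \<in> fixed j"
  by (simp add: fixed_def power_mult_distrib)

lemma power_fixed: "x \<in> fixed j \<Longrightarrow> x ^ n \<in> fixed j"
  by (induction n) (simp_all add: one_fixed mult_fixed)

lemma inverse_fixed: "x \<in> fixed j \<Longrightarrow> inverse x \<in> fixed j"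
  by (simp add: fixed_def power_inverse)

lemma fixed_mono: "x \<in> fixed i \<Longrightarrow> x \<in> fixed (i * n)"
proof (induction n)
  case (Suc n)
  then have "x ^ (q ^ (i * n)) = x" "x ^ (q ^ i) = x" by (simp_all add: fixed_def)
  then have "x ^ (q ^ i * q ^ (i * n)) = x" by (simp add: power_mult)
  then show ?case by (simp add: fixed_def power_add)
qed (simp add: fixed_def)

lemma finite_fixed: "j > 0 \<Longrightarrow> finite (fixed j)"
  using card_fixed[of j] q_gt_1 card.infinite by fastforce

lemma \<beta>_pow2: "\<beta> ^ (q ^ 2) = \<beta>"
proof -
  have "\<beta> ^ (q ^ 2) = (\<beta> ^ q) ^ q" by (simp add: power2_eq_square power_mult)
  then show ?thesis using \<beta> frob_minus[of \<beta> 1] by simp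
qed

lemma \<beta>_fixed: "\<beta> \<in> fixed 2"
  using \<beta>_pow2 by (simp add: fixed_def)

lemma s_pow: "s ^ (q ^ j) = s + of_nat j"
proof (induction j)
  case (Suc j)
  have nat_fixed: "(of_nat j :: 'a) ^ q = of_nat j"
    by (induction j) (use q_gt_1 frob_add[of _ _ 1] in \<open>simp_all add: power_0_left\<close>)
  have "s ^ (q ^ Suc j) = (s ^ (q ^ j)) ^ q" by (simp only: power_Suc2 power_mult)
  then show ?case using Suc s frob_add[of s "of_nat j" 1] nat_fixed by simp
qed simp

lemma s_fixed: "s \<in> fixed 3"
  using s_pow[of 3] three_zero by (simp add: fixed_def)

abbreviation F where "F \<equiv> fixed 6"
abbreviation \<omega> where "\<omega> \<equiv> \<beta> * s"

lemma fixed_1_F: "x \<in> fixed 1 \<Longrightarrow> x \<in> F" and fixed_2_F: "x \<in> fixed 2 \<Longrightarrow> x \<in> F"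
  and fixed_1_2: "x \<in> fixed 1 \<Longrightarrow> x \<in> fixed 2"
  using fixed_mono[of x 1 6] fixed_mono[of x 2 3] fixed_mono[of x 1 2] by simp_all

lemma \<omega>_F: "\<omega> \<in> F"
  using mult_fixed[OF fixed_2_F[OF \<beta>_fixed], of s] fixed_mono[OF s_fixed, of 2] by simp

text \<open>
  With this exponent, the power map on \<open>F\<close> is the norm to \<open>fixed 2\<close>.
\<close>

definition N :: nat where "N = q ^ 4 + q\<^sup>2 + 1"

definition base_line :: "'a set" where
  "base_line = {x + y * \<omega> | x y. x \<in> fixed 1 \<and> y \<in> fixed 1}"

definition norm_group :: "'a set" where
  "norm_group = {c. c ^ N = 1}"

text \<open>
  Over \<open>fixed 2\<close>, the conjugates of \<open>t = x + y * \<beta> * s\<close> are \<open>t\<close> and \<open>t \<plusminus> y * \<beta>\<close>, and the product of the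
  three is \<open>t ^ 3 - (y * \<beta>)\<^sup>2 * t\<close>, where cubing is additive.
\<close>

lemma power_N_base:
  assumes x: "x \<in> fixed 1" and y: "y \<in> fixed 1"
  shows "(x + y * \<omega>) ^ N = x ^ 3 - y\<^sup>2 * \<beta>\<^sup>2 * x + y ^ 3 * \<beta> ^ 3 * (s ^ 3 - s)"
proof -
  have conj: "(x + y * \<omega>) ^ (q ^ j) = x + y * \<beta> * (s + of_nat j)" if even: "even j" for j
  proof -
    obtain i where j: "j = 2 * i" using even by blast
    have "\<beta> ^ (q ^ j) = \<beta>" "x ^ (q ^ j) = x" "y ^ (q ^ j) = y"
      using fixed_mono[OF \<beta>_fixed, of i] fixed_mono[OF x, of j] fixed_mono[OF y, of j] j
      by (simp_all add: fixed_def)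
    then show ?thesis
      by (simp add: frob_add power_mult_distrib s_pow mult.assoc)
  qed
  have "(x + y * \<omega>) ^ N = (x + y * \<omega>) ^ (q ^ 4) * (x + y * \<omega>) ^ (q ^ 2) * (x + y * \<omega>)"
    by (simp add: N_def power_add)
  also have "\<dots> = (x + y * \<beta> * (s + 1)) * (x + y * \<beta> * (s - 1)) * (x + y * \<omega>)"
  proof -
    have "(2::'a) = - 1" using three_zero by (simp add: eq_neg_iff_add_eq_0)
    then show ?thesis
      using conj[of 4] conj[of 2] four_one by simp
  qed
  also have "\<dots> = (x + y * \<omega>) ^ 3 - (y * \<beta>)\<^sup>2 * (x + y * \<omega>)"
    by (simp add: algebra_simps power2_eq_square power3_eq_cube)
  also have "\<dots> = x ^ 3 - y\<^sup>2 * \<beta>\<^sup>2 * x + y ^ 3 * \<beta> ^ 3 * (s ^ 3 - s)"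
    unfolding cube_add by (simp add: algebra_simps power2_eq_square power3_eq_cube)
  finally show ?thesis .
qed

lemma s_cube: "s ^ 3 - s \<noteq> 0" "(s ^ 3 - s) ^ q = s ^ 3 - s"
proof -
  have pq: "(x ^ 3) ^ q = (x ^ q) ^ 3" for x :: 'a by (rule power_swap)
  show inv: "(s ^ 3 - s) ^ q = s ^ 3 - s"
    using frob_diff[of "s ^ 3" s 1] by (simp add: pq s cube_add)
  show "s ^ 3 - s \<noteq> 0"
  proof
    assume "s ^ 3 - s = 0"
    then have s3: "s ^ 3 = s" by simp
    have "s ^ (3 ^ i) = s" for i
      by (induction i) (simp_all add: s3 power_mult)
    then have "s ^ q = s" by (simp add: q_def)
    then show False using s by simp
  qed
qed

lemma exponent_three: "x + x + x = (0::'a)"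
proof -
  have "x + x + x = (1 + 1 + 1) * x" by (simp only: distrib_right mult_1_left)
  also have "(1 + 1 + 1 :: 'a) = 3" by simp
  finally show ?thesis by (simp only: three_zero mult_zero_left)
qed

lemma minus_self:
  assumes "- x = x" shows "x = (0::'a)"
proof -
  have "x + x = x + - x" by (simp only: assms)
  also have "\<dots> = 0" by (rule add.right_inverse)
  finally have "x + x + x = x" by (simp only: add_0_left)
  then show ?thesis by (simp only: exponent_three)
qed

text \<open>
  In the norm form, \<open>A x y\<close> is fixed by the power \<open>q\<close> and \<open>B y\<close> is negated, so both are determined by the
  norm. Then \<open>B y\<close> determines \<open>y\<close>. A nonzero difference \<open>D\<close> of two solutions \<open>x\<close> would satisfy
  \<open>D\<^sup>2 = (y * \<beta>)\<^sup>2\<close>, although \<open>D\<close> is fixed by the power \<open>q\<close> and \<open>y * \<beta>\<close> is negated.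
\<close>

lemma power_N_inj:
  assumes x: "x \<in> fixed 1" "x' \<in> fixed 1" and y: "y \<in> fixed 1" "y' \<in> fixed 1"
    and eq: "(x + y * \<omega>) ^ N = (x' + y' * \<omega>) ^ N"
  shows "x = x' \<and> y = y'"
proof -
  let ?c = "s ^ 3 - s"
  define A where "A = (\<lambda>x y :: 'a. x ^ 3 - y\<^sup>2 * \<beta>\<^sup>2 * x)"
  define B where "B = (\<lambda>y :: 'a. y ^ 3 * \<beta> ^ 3 * ?c)"
  have pq: "(x ^ n) ^ q = (x ^ q) ^ n" for x :: 'a and n by (rule power_swap)
  have fx: "z ^ q = z" if "z \<in> fixed 1" for z using that by (simp add: fixed_def)
  have A_conj: "A x y ^ q = A x y" if "x \<in> fixed 1" "y \<in> fixed 1" for x y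
    using frob_diff[of "x ^ 3" "y\<^sup>2 * \<beta>\<^sup>2 * x" 1] that by (simp add: A_def power_mult_distrib pq fx \<beta>)
  have B_conj: "B y ^ q = - B y" if "y \<in> fixed 1" for y
    using that by (simp add: B_def power_mult_distrib pq fx \<beta> s_cube)
  have e: "A x y + B y = A x' y' + B y'"
    using eq unfolding A_def B_def power_N_base[OF x(1) y(1)] power_N_base[OF x(2) y(2)] .
  then have "(A x y + B y) ^ q = (A x' y' + B y') ^ q" by simp
  then have e': "A x y - B y = A x' y' - B y'"
    using frob_add[of _ _ 1] A_conj[OF x(1) y(1)] A_conj[OF x(2) y(2)] B_conj[OF y(1)] B_conj[OF y(2)] by simp
  have "- (B y - B y') = B y - B y'"
  proof -
    have "B y - B y' = A x' y' - A x y" using e by (simp add: algebra_simps)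
    also have "\<dots> = B y' - B y" using e' by (simp add: algebra_simps)
    finally show ?thesis by (simp only: minus_diff_eq)
  qed
  then have "B y = B y'" using minus_self[of "B y - B y'"] by simp
  then have "y ^ 3 = y' ^ 3" using \<beta> s_cube(1) by (simp add: B_def)
  then have yy: "y = y'" by (rule cube_inj)
  have "x - x' = 0"
  proof (rule ccontr)
    define D where "D = x - x'"
    assume "x - x' \<noteq> 0"
    then have D0: "D \<noteq> 0" by (simp add: D_def)
    have "A x y = A x' y" using e yy by simp
    then have "x ^ 3 - x' ^ 3 = y\<^sup>2 * \<beta>\<^sup>2 * D"
      unfolding A_def D_def by (simp add: algebra_simps)
    moreover have "x ^ 3 = D ^ 3 + x' ^ 3" unfolding D_def by (simp flip: cube_add)
    ultimately have "D ^ 3 = y\<^sup>2 * \<beta>\<^sup>2 * D" by simp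
    then have "D * (D * D) = D * ((y * \<beta>) * (y * \<beta>))"
      by (simp add: algebra_simps power2_eq_square power3_eq_cube)
    then have "D * D = (y * \<beta>) * (y * \<beta>)" using D0 by simp
    then have D: "D = y * \<beta> \<or> D = - (y * \<beta>)" by (simp add: square_eq_iff)
    have "D ^ q = D" using diff_fixed x fx by (simp add: D_def)
    moreover have "(y * \<beta>) ^ q = - (y * \<beta>)" using y fx \<beta> by (simp add: power_mult_distrib)
    ultimately have "- (y * \<beta>) = y * \<beta>"
      using D frob_minus[of "y * \<beta>" 1] by auto
    then have "y * \<beta> = 0" by (rule minus_self)
    then show False using D D0 by auto
  qed
  then show ?thesis using yy by simp
qed

end

section \<open>The spread, and the kernel of its linear space\<close>

context frobenius_tower
begin

lemma coordinates_unique: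
  assumes "x \<in> fixed 1" "x' \<in> fixed 1" "y \<in> fixed 1" "y' \<in> fixed 1" "x + y * \<omega> = x' + y' * \<omega>"
  shows "x = x'" "y = y'"
  using power_N_inj[OF assms(1-4)] assms(5) by simp_all

lemma base_line_F: "base_line \<subseteq> F"
  using add_fixed mult_fixed fixed_1_F \<omega>_F by (auto simp: base_line_def)

lemma base_line_diff: "u \<in> base_line \<Longrightarrow> v \<in> base_line \<Longrightarrow> u - v \<in> base_line"
proof -
  assume "u \<in> base_line" "v \<in> base_line"
  then obtain x y x' y' where "x \<in> fixed 1" "y \<in> fixed 1" "x' \<in> fixed 1" "y' \<in> fixed 1"
    "u = x + y * \<omega>" "v = x' + y' * \<omega>" by (auto simp: base_line_def)
  moreover from this have "u - v = (x - x') + (y - y') * \<omega>" by (simp add: algebra_simps)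
  ultimately show ?thesis using diff_fixed unfolding base_line_def by blast
qed

lemma base_line_scale: "a \<in> fixed 1 \<Longrightarrow> u \<in> base_line \<Longrightarrow> a * u \<in> base_line"
proof -
  assume a: "a \<in> fixed 1" and "u \<in> base_line"
  then obtain x y where "x \<in> fixed 1" "y \<in> fixed 1" "u = x + y * \<omega>" by (auto simp: base_line_def)
  moreover from this have "a * u = a * x + (a * y) * \<omega>" by (simp add: algebra_simps)
  ultimately show ?thesis using mult_fixed[OF a] unfolding base_line_def by blast
qed

lemma one_base_line: "1 \<in> base_line" and \<omega>_base_line: "\<omega> \<in> base_line"
proof -
  have "1 = 1 + 0 * \<omega>" "\<omega> = 0 + 1 * \<omega>" by simp_all
  then show "1 \<in> base_line" "\<omega> \<in> base_line"
    using zero_fixed one_fixed unfolding base_line_def by blast+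
qed

lemma zero_base_line: "0 \<in> base_line"
  using base_line_diff[OF one_base_line one_base_line] by simp

lemma inj_power_N: "inj_on (\<lambda>u. u ^ N) base_line"
proof (rule inj_onI)
  fix u v assume "u \<in> base_line" "v \<in> base_line" and eq: "u ^ N = v ^ N"
  then obtain x y x' y' where xy: "x \<in> fixed 1" "y \<in> fixed 1" "x' \<in> fixed 1" "y' \<in> fixed 1"
    and uv: "u = x + y * \<omega>" "v = x' + y' * \<omega>" by (auto simp: base_line_def)
  then show "u = v" using power_N_inj[OF xy(1,3,2,4)] eq by simp
qed

lemma card_base_line: "card base_line = q\<^sup>2"
proof -
  have "base_line = (\<lambda>(x, y). x + y * \<omega>) ` (fixed 1 \<times> fixed 1)"
    by (auto simp: base_line_def)
  moreover have "inj_on (\<lambda>(x, y). x + y * \<omega>) (fixed 1 \<times> fixed 1)"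
  proof (rule inj_onI, clarify)
    fix x y x' y' assume "x \<in> fixed 1" "y \<in> fixed 1" "x' \<in> fixed 1" "y' \<in> fixed 1" "x + y * \<omega> = x' + y' * \<omega>"
    then show "x = x' \<and> y = y'" using coordinates_unique[of x x' y y'] by blast
  qed
  ultimately show ?thesis
    using card_fixed[of 1] by (simp add: card_image card_cartesian_product power2_eq_square)
qed

text \<open>
  This says that \<open>N * (q\<^sup>2 - 1) = q ^ 6 - 1\<close>, written without subtraction.
\<close>

lemma N_identity: "N * q\<^sup>2 + 1 = q ^ 6 + N"
  by (simp add: N_def algebra_simps flip: power_add)

lemma power_N_fixed: "u \<in> F \<Longrightarrow> u ^ N \<in> fixed 2"
proof -
  assume u: "u \<in> F"
  have "(u ^ N) ^ q\<^sup>2 * u = u ^ (N * q\<^sup>2 + 1)" by (simp add: power_mult)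
  also have "\<dots> = u ^ (q ^ 6) * u ^ N" unfolding N_identity by (rule power_add)
  also have "\<dots> = u ^ N * u" using u by (simp add: fixed_def)
  finally show ?thesis using zero_fixed[of 2] by (cases "u = 0") (simp_all add: fixed_def N_def power_0_left)
qed

text \<open>
  Injectivity turns into surjectivity because both sides have \<open>q\<^sup>2\<close> elements.
\<close>

lemma power_N_base_line: "(\<lambda>u. u ^ N) ` base_line = fixed 2"
proof (rule card_subset_eq)
  show "finite (fixed 2)" using finite_fixed by simp
  show "(\<lambda>u. u ^ N) ` base_line \<subseteq> fixed 2" using power_N_fixed base_line_F by auto
  show "card ((\<lambda>u. u ^ N) ` base_line) = card (fixed 2)"
    using card_image[OF inj_power_N] card_base_line card_fixed[of 2] by simp
qed

lemma norm_group_nonzero: "c \<in> norm_group \<Longrightarrow> c \<noteq> 0"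
  by (auto simp: norm_group_def N_def)

lemma norm_group_F: "norm_group \<subseteq> F"
proof
  fix c assume c: "c \<in> norm_group"
  have "c ^ (q ^ 6) * c ^ N = c ^ (N * q\<^sup>2 + 1)" unfolding N_identity by (rule power_add[symmetric])
  also have "\<dots> = (c ^ N) ^ q\<^sup>2 * c" by (simp add: power_mult)
  finally show "c \<in> F" using c by (simp add: norm_group_def fixed_def)
qed

lemma norm_group_one: "1 \<in> norm_group"
  by (simp add: norm_group_def)

lemma norm_group_mult: "c \<in> norm_group \<Longrightarrow> d \<in> norm_group \<Longrightarrow> c * d \<in> norm_group"
  by (simp add: norm_group_def power_mult_distrib)

lemma norm_group_inverse: "c \<in> norm_group \<Longrightarrow> inverse c \<in> norm_group"
  by (simp add: norm_group_def power_inverse)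

text \<open>
  Take \<open>u \<in> base_line\<close> with the norm of \<open>z\<close>; then \<open>z / u\<close> has norm 1.
\<close>

lemma polar_decomposition:
  assumes z: "z \<in> F" "z \<noteq> 0"
  obtains c u where "c \<in> norm_group" "u \<in> base_line" "u \<noteq> 0" "z = c * u"
proof -
  obtain u where u: "u \<in> base_line" "u ^ N = z ^ N"
    using power_N_fixed[OF z(1)] power_N_base_line by (metis imageE)
  have "u \<noteq> 0" using u(2) z(2) by (auto simp: power_0_left N_def)
  moreover from this have "z / u \<in> norm_group" "z = (z / u) * u"
    using u(2) z(2) by (simp_all add: norm_group_def power_divide)
  ultimately show ?thesis using that u(1) by blast
qed

lemma polar_decomposition_unique:
  assumes "c \<in> norm_group" "c' \<in> norm_group" "u \<in> base_line" "u' \<in> base_line" "u \<noteq> 0" "c * u = c' * u'"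
  shows "c = c'" "u = u'"
proof -
  have "(c * u) ^ N = (c' * u') ^ N" by (simp only: assms(6))
  then have "u ^ N = u' ^ N" using assms(1,2) by (simp add: norm_group_def power_mult_distrib)
  then show "u = u'" by (rule inj_onD[OF inj_power_N _ assms(3,4)])
  then show "c = c'" using assms(5,6) by simp
qed

text \<open>
  For \<open>z = c * u\<close> with \<open>u \<noteq> 0\<close> the factor \<open>c\<close> is unique, and this is the translate \<open>c * base_line\<close>.
\<close>

definition part :: "'a \<Rightarrow> 'a set" where
  "part z = {c * w | c w. c \<in> norm_group \<and> w \<in> base_line \<and> (\<exists>u\<in>base_line. z = c * u)}"

lemma part_polar:
  assumes "c \<in> norm_group" "u \<in> base_line" "u \<noteq> 0"
  shows "part (c * u) = (*) c ` base_line"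
proof
  show "(*) c ` base_line \<subseteq> part (c * u)"
    using assms by (auto simp: part_def)
  show "part (c * u) \<subseteq> (*) c ` base_line"
    using polar_decomposition_unique(1)[OF assms(1) _ assms(2) _ assms(3)] by (auto simp: part_def)
qed

lemma part_translate:
  assumes z: "z \<in> F" "z \<noteq> 0"
  obtains c where "c \<in> norm_group" "part z = (*) c ` base_line"
  using polar_decomposition[OF z] part_polar by metis

lemma card_mult_base_line: "c \<in> norm_group \<Longrightarrow> card ((*) c ` base_line) = q\<^sup>2"
  using norm_group_nonzero card_base_line by (subst card_image) (auto simp: inj_on_def)

sublocale additive_partition F part "q\<^sup>2"
proof
  show "finite F" using finite_fixed by simp
  show "0 \<in> F" by (rule zero_fixed)
  show "x - y \<in> F" if "x \<in> F" "y \<in> F" for x y using diff_fixed that by blast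
  fix z assume z: "z \<in> F" "z \<noteq> 0"
  obtain c u where cu: "c \<in> norm_group" "u \<in> base_line" "u \<noteq> 0" "z = c * u"
    using polar_decomposition[OF z] .
  have pz: "part z = (*) c ` base_line" using part_polar cu by simp
  show "part z \<subseteq> F" unfolding pz using base_line_F norm_group_F cu(1) mult_fixed by blast
  show "z \<in> part z" unfolding pz using cu by blast
  show "x - y \<in> part z" if xy: "x \<in> part z" "y \<in> part z" for x y
  proof -
    obtain v w where "v \<in> base_line" "w \<in> base_line" "x = c * v" "y = c * w" using xy unfolding pz by blast
    then have "x - y = c * (v - w)" "v - w \<in> base_line" using base_line_diff by (simp_all add: algebra_simps)
    then show ?thesis unfolding pz by blast
  qed
  show "part y = part z" if y: "y \<in> part z" "y \<noteq> 0" for y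
  proof -
    obtain w where "w \<in> base_line" "y = c * w" using y unfolding pz by blast
    then show ?thesis using part_polar[of c w] cu(1) y(2) pz by auto
  qed
  show card: "card (part z) = q\<^sup>2" unfolding pz using card_mult_base_line cu(1) .
  have "q\<^sup>2 < q ^ 6" using q_gt_1 by (intro power_strict_increasing) auto
  then show "part z \<noteq> F" using card card_fixed[of 6] by auto
qed

lemma one_F: "1 \<in> F" by (rule one_fixed)

lemma part_one: "part 1 = base_line"
  using part_polar[OF norm_group_one one_base_line] by simp

lemma part_mult:
  assumes c: "c \<in> norm_group" and z: "z \<in> F" "z \<noteq> 0"
  shows "part (c * z) = (*) c ` part z"
proof -
  obtain d u where du: "d \<in> norm_group" "u \<in> base_line" "u \<noteq> 0" "z = d * u"
    using polar_decomposition[OF z] .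
  have "part (c * z) = part ((c * d) * u)" by (simp add: du mult.assoc)
  also have "\<dots> = (*) (c * d) ` base_line" using part_polar norm_group_mult c du by simp
  also have "\<dots> = (*) c ` part z" using part_polar du by (simp add: image_image mult.assoc)
  finally show ?thesis .
qed

lemma part_scale:
  assumes z: "z \<in> F" "z \<noteq> 0" and a: "a \<in> fixed 1" and x: "x \<in> part z"
  shows "a * x \<in> part z"
proof -
  obtain c where c: "part z = (*) c ` base_line" using part_translate[OF z] .
  then obtain w where "w \<in> base_line" "x = c * w" using x by blast
  then have "a * x = c * (a * w)" "a * w \<in> base_line" using base_line_scale a by (simp_all add: algebra_simps)
  then show ?thesis unfolding c by blast
qed

lemma parts_transitive:
  assumes z: "z \<in> F" "z \<noteq> 0" and z': "z' \<in> F" "z' \<noteq> 0"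
  obtains c where "c \<in> norm_group" "part z' = (*) c ` part z"
proof -
  obtain c where c: "c \<in> norm_group" "part z = (*) c ` base_line" using part_translate[OF z] .
  obtain d where d: "d \<in> norm_group" "part z' = (*) d ` base_line" using part_translate[OF z'] .
  have cancel: "d * inverse c * (c * x) = d * x" for x
    using norm_group_nonzero[OF c(1)] by simp
  have "part z' = (*) (d * inverse c) ` part z"
    unfolding c d image_image by (simp only: cancel)
  then show ?thesis using that norm_group_mult norm_group_inverse c d by blast
qed

text \<open>
  A crude bound: products of an element of \<open>norm_group\<close> and one of \<open>base_line\<close> exhaust \<open>F\<close>.
\<close>

lemma card_norm_group: "q ^ 4 \<le> card norm_group"
proof -
  have fin: "finite norm_group" using norm_group_F finite_F finite_subset by blast
  have "F \<subseteq> (\<lambda>(c, u). c * u) ` (norm_group \<times> base_line)"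
  proof
    fix z assume "z \<in> F"
    then show "z \<in> (\<lambda>(c, u). c * u) ` (norm_group \<times> base_line)"
    proof (cases "z = 0")
      case True
      then show ?thesis using norm_group_one zero_base_line by (intro image_eqI[of _ _ "(1, 0)"]) auto
    next
      case False
      then obtain c u where "c \<in> norm_group" "u \<in> base_line" "z = c * u"
        using polar_decomposition \<open>z \<in> F\<close> by metis
      then show ?thesis by (intro image_eqI[of _ _ "(c, u)"]) auto
    qed
  qed
  moreover have "finite base_line" using base_line_F finite_F finite_subset by blast
  ultimately have "card F \<le> card (norm_group \<times> base_line)"
    using fin by (intro surj_card_le) auto
  then have "q ^ 4 * q\<^sup>2 \<le> card norm_group * q\<^sup>2"
    using card_fixed[of 6] card_base_line by (simp add: card_cartesian_product flip: power_add)
  moreover have "q\<^sup>2 > 0" using q_gt_1 by simp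
  ultimately show ?thesis by (simp only: mult_le_cancel2 simp_thms)
qed

lemma \<omega>_conj: "\<omega> ^ (q ^ 2) = \<omega> - \<beta>"
proof -
  have "\<omega> ^ (q ^ 2) = \<beta> * (s + of_nat 2)" using s_pow[of 2] by (simp add: power_mult_distrib \<beta>_pow2)
  moreover have "(of_nat 2 :: 'a) = - 1" using three_zero by (simp add: eq_neg_iff_add_eq_0)
  ultimately show ?thesis by (simp add: algebra_simps)
qed

text \<open>
  A relation \<open>\<omega>\<^sup>2 = x + y * \<omega>\<close> and its conjugate under the power \<open>q\<^sup>2\<close>, which maps \<open>\<omega>\<close> to \<open>\<omega> - \<beta>\<close>, have
  a linear equation for \<open>\<omega>\<close> over \<open>fixed 2\<close> as their difference.
\<close>

lemma \<omega>_square: "\<omega> * \<omega> \<notin> base_line"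
proof
  assume "\<omega> * \<omega> \<in> base_line"
  then obtain x y where xy: "x \<in> fixed 1" "y \<in> fixed 1" "\<omega> * \<omega> = x + y * \<omega>" by (auto simp: base_line_def)
  then have conj: "x ^ (q ^ 2) = x" "y ^ (q ^ 2) = y"
    using fixed_1_2 by (auto simp: fixed_def)
  have "(\<omega> * \<omega>) ^ (q ^ 2) = (x + y * \<omega>) ^ (q ^ 2)" by (simp only: xy)
  then have "(\<omega> - \<beta>) * (\<omega> - \<beta>) = x + y * (\<omega> - \<beta>)"
    unfolding frob_add power_mult_distrib[of \<omega> \<omega>] power_mult_distrib[of y \<omega>] \<omega>_conj conj .
  then have "\<omega> * \<omega> - \<beta> * (\<omega> + \<omega> - \<beta>) = x + y * \<omega> - \<beta> * y"
    by (simp only: algebra_simps)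
  then have "\<beta> * (\<omega> + \<omega> - \<beta>) = \<beta> * y" by (simp only: xy) simp
  then have "\<omega> + \<omega> - \<beta> = y" using \<beta>(1) by simp
  moreover have "\<omega> + \<omega> = - \<omega>" using exponent_three[of \<omega>] by (simp only: eq_neg_iff_add_eq_0)
  ultimately have "y = - \<omega> - \<beta>" by (simp only:)
  then have "\<omega> = - (\<beta> + y)" by simp
  then have "\<omega> \<in> fixed 2"
    using \<beta>_fixed fixed_1_2[OF xy(2)] add_fixed uminus_fixed by metis
  then show False using \<omega>_conj \<beta>(1) by (simp add: fixed_def)
qed

text \<open>
  If \<open>d a = 0\<close> and \<open>x\<close> lies in another part, then \<open>d x = d (a + x)\<close> lies in both \<open>part x\<close> and
  \<open>part (a + x)\<close>, which share only \<open>0\<close>. Points of \<open>part a\<close> are reached by a second such step.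
\<close>

lemma kernel_element_rigid:
  assumes add: "\<And>x y. x \<in> F \<Longrightarrow> y \<in> F \<Longrightarrow> d (x + y) = d x + d y"
    and part: "\<And>z. z \<in> F \<Longrightarrow> z \<noteq> 0 \<Longrightarrow> d z \<in> part z"
    and a: "a \<in> F" "a \<noteq> 0" "d a = 0" and x: "x \<in> F"
  shows "d x = 0"
proof -
  have off: "d x = 0" if a: "a \<in> F" "a \<noteq> 0" "d a = 0" and x: "x \<in> F" "x \<noteq> 0" and ni: "a \<notin> part x" for a x
  proof -
    have ax: "a + x \<notin> part x" using part_diff[of x "a + x" x] part_self[OF x] x ni by auto
    then have "a + x \<noteq> 0" using part_zero[OF x] by auto
    then have "d x \<in> part (a + x)" using part[of "a + x"] add[OF a(1) x(1)] add_F[OF a(1) x(1)] a(3) by simp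
    then show ?thesis
      using parts_meet_trivially[OF x _ _ ax] part[OF x] \<open>a + x \<noteq> 0\<close> add_F[OF a(1) x(1)] by blast
  qed
  have d0: "d 0 = 0" using add[OF zero_F zero_F] by (metis add_0 add_cancel_right_right)
  show ?thesis
  proof (cases "x = 0 \<or> a \<notin> part x")
    case True
    then show ?thesis using d0 off[OF a x] by blast
  next
    case False
    then have x0: "x \<noteq> 0" and ax: "part a = part x" using part_eq[OF x] a(2) by auto
    obtain z where z: "z \<in> F" "z \<notin> part a"
      using part_subset[OF a(1,2)] part_proper[OF a(1,2)] by blast
    have z0: "z \<noteq> 0" using z(2) part_zero[OF a(1,2)] by auto
    have "a \<notin> part z" using part_eq[OF z(1) z0 _ a(2)] part_self[OF z(1) z0] z(2) by auto
    then have "d z = 0" using off[OF a z(1) z0] by blast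
    then show ?thesis using off[OF z(1) z0 _ x x0] z(2) ax by simp
  qed
qed

lemma of_nat_N: "(of_nat N :: 'a) = 1"
proof -
  have "(of_nat q :: 'a) = 0" using k_pos three_zero by (simp add: q_def)
  then show ?thesis by (simp add: N_def)
qed

lemma power_N_fixed_1: "b \<in> fixed 1 \<Longrightarrow> b ^ N = b ^ 3"
  using fixed_mono[of b 1 4] fixed_mono[of b 1 2]
  by (simp add: N_def power_add fixed_def power3_eq_cube)

text \<open>
  The conjugate \<open>x \<mapsto> inverse c * d (c * x)\<close> again preserves all parts, and its value at \<open>1\<close> has the form
  \<open>a + b * \<omega>\<close>; by rigidity it is \<open>x \<mapsto> a * x + b * d x\<close>. Conjugating \<open>N\<close> times must return to \<open>d\<close>. This
  amounts to the affine map \<open>t \<mapsto> a + b * t\<close> over \<open>fixed 1\<close> having an order that divides \<open>N\<close>, and \<open>N\<close> is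
  prime to the order \<open>q * (q - 1)\<close> of the group of such maps.
\<close>

lemma kernel_commutes_norm_group:
  assumes add: "\<And>x y. x \<in> F \<Longrightarrow> y \<in> F \<Longrightarrow> d (x + y) = d x + d y"
    and part: "\<And>z. z \<in> F \<Longrightarrow> z \<noteq> 0 \<Longrightarrow> d z \<in> part z"
    and d1: "d 1 = \<omega>" and c: "c \<in> norm_group" and x: "x \<in> F"
  shows "d (c * x) = c * d x"
proof -
  have cF: "c \<in> F" and c0: "c \<noteq> 0" using c norm_group_F norm_group_nonzero by auto
  have conj_part: "inverse c * d (c * z) \<in> part z" if z: "z \<in> F" "z \<noteq> 0" for z
  proof -
    have "d (c * z) \<in> (*) c ` part z"
      using part[OF mult_fixed[OF cF z(1)]] c0 z(2) part_mult[OF c z] by simp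
    then obtain w where "w \<in> part z" "d (c * z) = c * w" by blast
    moreover have "inverse c * (c * w) = w" using c0 by (simp flip: mult.assoc)
    ultimately show ?thesis by (simp only:)
  qed
  obtain a b where ab: "a \<in> fixed 1" "b \<in> fixed 1" and conj_one: "inverse c * d (c * 1) = a + b * \<omega>"
    using conj_part[OF one_F] unfolding part_one base_line_def by auto
  have step: "d (c * x) = c * (a * x + b * d x)" if x: "x \<in> F" for x
  proof -
    define e where "e = (\<lambda>x. inverse c * d (c * x) - a * x - b * d x)"
    have "e x = 0"
    proof (rule kernel_element_rigid[of e 1])
      show "e (x + y) = e x + e y" if "x \<in> F" "y \<in> F" for x y
        using add[OF that] add[OF mult_fixed[OF cF that(1)] mult_fixed[OF cF that(2)]]
        by (simp add: e_def algebra_simps)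
      show "e z \<in> part z" if z: "z \<in> F" "z \<noteq> 0" for z
        unfolding e_def
        using conj_part[OF z] part_scale[OF z ab(1) part_self[OF z]] part_scale[OF z ab(2) part[OF z]]
        by (intro part_diff[OF z])
      show "e 1 = 0" using conj_one by (simp add: e_def d1)
    qed (use one_F x in auto)
    then have "inverse c * d (c * x) = a * x + b * d x" by (simp add: e_def algebra_simps)
    moreover have "c * (inverse c * d (c * x)) = d (c * x)" using c0 by (simp flip: mult.assoc)
    ultimately show ?thesis by (simp only:)
  qed
  have pow_F: "c ^ n * x \<in> F" if "x \<in> F" for n x
    using mult_fixed[OF power_fixed[OF cF] that] .
  have iter: "\<exists>A\<in>fixed 1. \<forall>x\<in>F. d (c ^ n * x) = c ^ n * (A * x + b ^ n * d x)" for n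
  proof (induction n)
    case 0
    show ?case using zero_fixed by (intro bexI[of _ 0]) auto
  next
    case (Suc n)
    then obtain A where A: "A \<in> fixed 1" "\<And>x. x \<in> F \<Longrightarrow> d (c ^ n * x) = c ^ n * (A * x + b ^ n * d x)" by blast
    have "d (c ^ Suc n * x) = c ^ Suc n * ((a + b * A) * x + b ^ Suc n * d x)" if x: "x \<in> F" for x
    proof -
      have "d (c ^ Suc n * x) = d (c * (c ^ n * x))" by (simp add: mult.assoc)
      also have "\<dots> = c * (a * (c ^ n * x) + b * d (c ^ n * x))" by (rule step[OF pow_F[OF x]])
      also have "\<dots> = c ^ Suc n * ((a + b * A) * x + b ^ Suc n * d x)"
        unfolding A(2)[OF x] by (simp add: algebra_simps)
      finally show ?thesis .
    qed
    then show ?case using add_fixed[OF ab(1) mult_fixed[OF ab(2) A(1)]] by blast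
  qed
  have cN: "c ^ N = 1" using c by (simp add: norm_group_def)
  have b: "b = 1"
  proof -
    obtain A where A: "A \<in> fixed 1" "\<omega> = A + b ^ N * \<omega>"
      using iter[of N] one_F cN d1 by auto
    have "0 + 1 * \<omega> = A + b ^ N * \<omega>" using A(2) by simp
    then have "1 = b ^ N"
      using coordinates_unique(2)[OF zero_fixed A(1) one_fixed power_fixed[OF ab(2)]] by blast
    \<comment> \<open>For \<open>b\<close> in the field with \<open>q\<close> elements, each of the three terms of \<open>N\<close> contributes a factor \<open>b\<close>.\<close>
    then have "b ^ 3 = 1 ^ 3" using power_N_fixed_1[OF ab(2)] by simp
    then show ?thesis by (rule cube_inj)
  qed
  have iter1: "d (c ^ n * x) = c ^ n * (of_nat n * a * x + d x)" if "x \<in> F" for n x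
  proof (induction n)
    case (Suc n)
    have "d (c ^ Suc n * x) = d (c * (c ^ n * x))" by (simp add: mult.assoc)
    also have "\<dots> = c * (a * (c ^ n * x) + d (c ^ n * x))" using step[OF pow_F[OF that]] b by simp
    also have "\<dots> = c ^ Suc n * (of_nat (Suc n) * a * x + d x)"
      unfolding Suc by (simp add: algebra_simps)
    finally show ?case .
  qed simp
  \<comment> \<open>In characteristic 3, \<open>N = q ^ 4 + q\<^sup>2 + 1\<close> is congruent to 1, so \<open>N * a = 0\<close> gives \<open>a = 0\<close>.\<close>
  have "a = 0" using iter1[OF one_F, of N] cN d1 of_nat_N by simp
  then show ?thesis using step[OF x] b by simp
qed

text \<open>
  The set \<open>Z\<close> of multipliers that commute with \<open>d\<close> is a subfield of \<open>F\<close> containing \<open>norm_group\<close>, so it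
  has at least \<open>q ^ 4\<close> of the \<open>q ^ 6\<close> elements and is all of \<open>F\<close>. Hence \<open>d \<omega> = \<omega> * d 1 = \<omega> * \<omega>\<close>.
\<close>

lemma no_kernel_element_maps_one_to_omega:
  assumes add: "\<And>x y. x \<in> F \<Longrightarrow> y \<in> F \<Longrightarrow> d (x + y) = d x + d y"
    and part: "\<And>z. z \<in> F \<Longrightarrow> z \<noteq> 0 \<Longrightarrow> d z \<in> part z"
    and d1: "d 1 = \<omega>"
  shows False
proof -
  define Z where "Z = {x \<in> F. \<forall>y\<in>F. d (x * y) = x * d y}"
  have norm_Z: "norm_group \<subseteq> Z"
    using kernel_commutes_norm_group[OF add part d1] norm_group_F by (auto simp: Z_def)
  have Z_F: "Z \<subseteq> F" by (auto simp: Z_def)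
  have Z_mult: "x * y \<in> Z" if "x \<in> Z" "y \<in> Z" for x y
    using that mult_fixed by (auto simp: Z_def mult.assoc)
  have d_diff: "d (x - y) = d x - d y" if "x \<in> F" "y \<in> F" for x y
    using add[of "x - y" y] that diff_F by simp
  have Z_diff: "x - y \<in> Z" if "x \<in> Z" "y \<in> Z" for x y
    using that mult_fixed diff_F by (auto simp: Z_def left_diff_distrib d_diff)
  have Z_inverse: "inverse x \<in> Z" if x: "x \<in> Z" "x \<noteq> 0" for x
  proof -
    have "d (inverse x * y) = inverse x * d y" if y: "y \<in> F" for y
    proof -
      have "inverse x * y \<in> F" using x y mult_fixed inverse_fixed by (auto simp: Z_def)
      then have "d (x * (inverse x * y)) = x * d (inverse x * y)" using x by (auto simp: Z_def)
      moreover have "x * (inverse x * y) = y" using x(2) by (simp flip: mult.assoc)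
      ultimately show ?thesis using x(2) by (simp add: field_simps)
    qed
    then show ?thesis using x inverse_fixed by (auto simp: Z_def)
  qed
  have "F \<subseteq> Z"
  proof (rule ccontr)
    assume "\<not> F \<subseteq> Z"
    then obtain x where x: "x \<in> F" "x \<notin> Z" by blast
    \<comment> \<open>If \<open>x\<close> were outside the subfield \<open>Z\<close>, then \<open>Z + x * Z\<close> would have more than \<open>q ^ 6\<close> elements.\<close>
    have inj: "inj_on (\<lambda>(v, w). v + x * w) (Z \<times> Z)"
    proof (rule inj_onI, clarify)
      fix v w v' w' assume Z: "v \<in> Z" "w \<in> Z" "v' \<in> Z" "w' \<in> Z" and eq: "v + x * w = v' + x * w'"
      have e: "x * (w - w') = v' - v" using eq by (simp add: algebra_simps)
      have "w = w'"
      proof (rule ccontr)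
        assume "w \<noteq> w'"
        then have "x = (v' - v) * inverse (w - w')" using e by (simp add: field_simps)
        then show False using Z_mult Z_diff Z_inverse Z \<open>w \<noteq> w'\<close> x(2) by simp
      qed
      then show "v = v' \<and> w = w'" using eq by simp
    qed
    have "(\<lambda>(v, w). v + x * w) ` (Z \<times> Z) \<subseteq> F"
      using subsetD[OF Z_F] by (auto intro!: add_F mult_fixed x(1))
    then have "card (Z \<times> Z) \<le> card F"
      by (rule card_inj_on_le[OF inj _ finite_F])
    then have ZZ: "card Z * card Z \<le> q ^ 6"
      using card_fixed[of 6] by (simp add: card_cartesian_product)
    have "q ^ 4 \<le> card Z"
      using card_norm_group card_mono[OF finite_subset[OF Z_F finite_F] norm_Z] by simp
    then have "q ^ 4 * q ^ 4 \<le> card Z * card Z" by (intro mult_le_mono)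
    then have "q ^ 8 \<le> q ^ 6" using ZZ by (simp flip: power_add)
    then show False using q_gt_1 by (simp add: power_increasing_iff)
  qed
  then have "d (\<omega> * 1) = \<omega> * d 1"
    using \<omega>_F one_F unfolding Z_def by blast
  then have "d \<omega> = \<omega> * \<omega>" using d1 by simp
  moreover have "\<omega> \<noteq> 0" using \<omega>_conj \<beta>(1) q_gt_1 by (auto simp: power_0_left)
  then have "part \<omega> = part 1" using part_eq[OF one_F] part_one \<omega>_base_line by simp
  then have "d \<omega> \<in> base_line" using part[OF \<omega>_F \<open>\<omega> \<noteq> 0\<close>] part_one by simp
  ultimately show False using \<omega>_square by simp
qed

lemma not_planar_dilatable:
  assumes planar: "planar F coset_lines (q\<^sup>2 ^ 2)" and dil: "dilatable F coset_lines"
  shows False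
proof -
  have \<omega>0: "\<omega> \<noteq> 0" using \<omega>_conj \<beta>(1) q_gt_1 by (auto simp: power_0_left)
  have "base_line \<in> coset_lines" using part_line[OF one_F] part_one by simp
  then obtain d where d: "dilatation F coset_lines d" "d 0 = 0" "d 1 = \<omega>"
    using dil zero_base_line one_base_line \<omega>_base_line \<omega>0 unfolding dilatable_def by (metis zero_neq_one)
  show False
  proof (rule no_kernel_element_maps_one_to_omega[of d])
    show "d (x + y) = d x + d y" if "x \<in> F" "y \<in> F" for x y
      using dilatation_additive[OF exponent_three planar d(1,2) that] .
    show "d z \<in> part z" if "z \<in> F" "z \<noteq> 0" for z
      using central_dilatation_preserves_part[OF d(1,2) that] part_self[OF that] by blast
  qed (rule d(3))
qed

end

section \<open>Groups of affine maps acting on lines\<close>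

lemma linear_space_image:
  assumes L: "linear_space (set_space P \<Lambda>)" and e: "inj_on e P" and sub: "\<Lambda> \<subseteq> Pow P"
  shows "linear_space (set_space (e ` P) ((`) e ` \<Lambda>))"
proof -
  interpret linear_space "set_space P \<Lambda>" by (rule L)
  have mem: "e x \<in> e ` l \<longleftrightarrow> x \<in> l" if "x \<in> P" "l \<in> \<Lambda>" for x l
    using inj_on_image_mem_iff[OF e that(1)] that sub by blast
  have inj_lines: "e ` l = e ` l' \<longleftrightarrow> l = l'" if "l \<in> \<Lambda>" "l' \<in> \<Lambda>" for l l'
    using inj_on_image_eq_iff[OF e] that sub by blast
  have trace: "{x \<in> e ` P. x \<in> e ` l} = e ` {x \<in> P. x \<in> l}" if "l \<in> \<Lambda>" for l
    using mem that sub by blast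
  have card_image_e: "card (e ` A) = card A" if "A \<subseteq> P" for A
    using card_image inj_on_subset[OF e that] by blast
  show ?thesis
  proof (unfold_locales, unfold incidence_structure.simps)
    show "finite (e ` P)" using finite_points by simp
  next
    fix x y assume "x \<in> e ` P" "y \<in> e ` P" "x \<noteq> y"
    then obtain x' y' where xy: "x = e x'" "y = e y'" "x' \<in> P" "y' \<in> P" "x' \<noteq> y'" by auto
    have ex1: "\<exists>!l. l \<in> \<Lambda> \<and> x' \<in> l \<and> y' \<in> l"
      using joining_line[of x' y'] xy(3-5) by simp
    then obtain l where l: "l \<in> \<Lambda>" "x' \<in> l" "y' \<in> l" by blast
    have uniq: "l' = l" if "l' \<in> \<Lambda>" "x' \<in> l'" "y' \<in> l'" for l'
      using ex1 l that by blast
    show "\<exists>!l. l \<in> (`) e ` \<Lambda> \<and> x \<in> l \<and> y \<in> l"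
    proof (rule ex1I[of _ "e ` l"])
      show "e ` l \<in> (`) e ` \<Lambda> \<and> x \<in> e ` l \<and> y \<in> e ` l" using l xy by blast
      fix m assume m: "m \<in> (`) e ` \<Lambda> \<and> x \<in> m \<and> y \<in> m"
      then obtain l' where l': "l' \<in> \<Lambda>" "m = e ` l'" by blast
      then have "x' \<in> l'" "y' \<in> l'" using m xy mem by auto
      then show "m = e ` l" using uniq l' by auto
    qed
  next
    fix x assume "x \<in> e ` P"
    then obtain x' where x: "x = e x'" "x' \<in> P" by auto
    obtain l l' where l: "l \<in> \<Lambda>" "l' \<in> \<Lambda>" "l \<noteq> l'" "x' \<in> l" "x' \<in> l'"
      using two_lines_on_point[unfolded incidence_structure.simps, OF x(2)] by blast
    then have "e ` l \<noteq> e ` l'" using inj_lines by blast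
    then show "\<exists>l l'. l \<in> (`) e ` \<Lambda> \<and> l' \<in> (`) e ` \<Lambda> \<and> l \<noteq> l' \<and> x \<in> l \<and> x \<in> l'"
      using l x by blast
  next
    fix l assume "l \<in> (`) e ` \<Lambda>"
    then obtain l' where l: "l' \<in> \<Lambda>" "l = e ` l'" by blast
    obtain x y where "x \<in> P" "y \<in> P" "x \<noteq> y" "x \<in> l'" "y \<in> l'"
      using two_points_on_line[unfolded incidence_structure.simps, OF l(1)] by blast
    moreover from this have "e x \<noteq> e y" using e by (auto dest: inj_onD)
    ultimately show "\<exists>x y. x \<in> e ` P \<and> y \<in> e ` P \<and> x \<noteq> y \<and> x \<in> l \<and> y \<in> l"
      using l by blast
  next
    obtain l where l: "l \<in> \<Lambda>" "card {x \<in> P. x \<in> l} > 2" using nontrivial by auto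
    then have "card {x \<in> e ` P. x \<in> e ` l} > 2" using trace[OF l(1)] card_image_e[of "{x \<in> P. x \<in> l}"] by simp
    then show "\<exists>l\<in>(`) e ` \<Lambda>. 2 < card {x \<in> e ` P. x \<in> l}" using l by blast
  next
    obtain S where S: "S \<subseteq> P" "card S = 4"
      and nc: "\<And>T. T \<subseteq> S \<Longrightarrow> card T = 3 \<Longrightarrow> \<not> collinear (set_space P \<Lambda>) T"
      using nondegenerate by auto
    have "\<not> collinear (set_space (e ` P) ((`) e ` \<Lambda>)) T" if T: "T \<subseteq> e ` S" "card T = 3" for T
    proof
      assume "collinear (set_space (e ` P) ((`) e ` \<Lambda>)) T"
      then obtain l where l: "l \<in> \<Lambda>" "T \<subseteq> e ` l" by (auto simp: collinear_def)
      obtain T' where T': "T' \<subseteq> S" "T = e ` T'" using T(1) by (meson subset_imageE)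
      have "card T' = 3" using card_image_e[of T'] T' T(2) S(1) by auto
      moreover have "x \<in> l" if x: "x \<in> T'" for x
        using mem[OF _ l(1), of x] x l(2) T' S(1) by blast
      then have "collinear (set_space P \<Lambda>) T'"
        using l(1) by (auto simp: collinear_def)
      ultimately show False using nc T'(1) by blast
    qed
    moreover have "card (e ` S) = 4" using card_image_e[OF S(1)] S(2) by simp
    ultimately show "\<exists>S\<subseteq>e ` P. card S = 4 \<and>
        (\<forall>T\<subseteq>S. card T = 3 \<longrightarrow> \<not> collinear (set_space (e ` P) ((`) e ` \<Lambda>)) T)"
      using S(1) by (intro exI[of _ "e ` S"]) blast
  qed
qed

lemma isomorphic_set_spaceE:
  assumes iso: "isomorphic (set_space P \<Lambda>) (set_space Q M)" and sub: "\<Lambda> \<subseteq> Pow P" "M \<subseteq> Pow Q"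
  obtains g where "bij_betw g P Q" "M = (`) g ` \<Lambda>"
proof -
  obtain g h where g: "bij_betw g P Q" and h: "bij_betw h \<Lambda> M"
    and inc: "\<And>x l. x \<in> P \<Longrightarrow> l \<in> \<Lambda> \<Longrightarrow> g x \<in> h l \<longleftrightarrow> x \<in> l"
    using iso by (auto simp: isomorphic_def)
  have "h l = g ` l" if l: "l \<in> \<Lambda>" for l
  proof
    show "g ` l \<subseteq> h l" using inc l sub(1) by blast
    show "h l \<subseteq> g ` l"
    proof
      fix y assume y: "y \<in> h l"
      then have "y \<in> Q" using h l sub(2) by (auto simp: bij_betw_def)
      then obtain x where "x \<in> P" "y = g x" using g by (auto simp: bij_betw_def)
      then show "y \<in> g ` l" using inc l y by blast
    qed
  qed
  then have "M = (`) g ` \<Lambda>" using h by (auto simp: bij_betw_def)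
  then show ?thesis using that g by blast
qed

text \<open>
  Each \<open>f \<in> M\<close> induces a map on \<open>\<Lambda>\<close>, which is onto because the inverse of \<open>f\<close> also preserves \<open>\<Lambda>\<close>. The
  resulting pairs are the image of \<open>M\<close> under a homomorphism.
\<close>

lemma subgroup_automorphisms_from_points:
  assumes M: "subgroup M (BijGroup P)" and sub: "\<Lambda> \<subseteq> Pow P"
    and pres: "\<And>f l. f \<in> M \<Longrightarrow> l \<in> \<Lambda> \<Longrightarrow> f ` l \<in> \<Lambda>"
  shows "subgroup ((\<lambda>f. (f, \<lambda>l\<in>\<Lambda>. f ` l)) ` M) (automorphism_group_of (set_space P \<Lambda>))"
proof -
  let ?A = "automorphism_group_of (set_space P \<Lambda>)" and ?\<Phi> = "\<lambda>f. (f, \<lambda>l\<in>\<Lambda>. f ` l)"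
  let ?M = "(BijGroup P)\<lparr>carrier := M\<rparr>"
  interpret M: group ?M
    using subgroup.subgroup_is_group[OF M group_BijGroup] .
  have M_Bij: "M \<subseteq> Bij P" using subgroup.subset[OF M] by (simp add: BijGroup_def)
  have bij: "bij_betw f P P" if "f \<in> M" for f using M_Bij that by (auto simp: Bij_def)
  have lines_Bij: "(\<lambda>l\<in>\<Lambda>. f ` l) \<in> Bij \<Lambda>" if f: "f \<in> M" for f
  proof -
    have inj: "inj_on f P" using bij[OF f] by (simp add: bij_betw_def)
    have "inj_on (\<lambda>l\<in>\<Lambda>. f ` l) \<Lambda>"
      using inj_on_image_eq_iff[OF inj] sub by (auto intro!: inj_onI)
    moreover have "l \<in> (\<lambda>l\<in>\<Lambda>. f ` l) ` \<Lambda>" if l: "l \<in> \<Lambda>" for l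
    proof -
      define g where "g = (\<lambda>x\<in>P. inv_into P f x)"
      have "g \<in> M"
        using subgroup.m_inv_closed[OF M f] inv_BijGroup[of f P] M_Bij f by (auto simp: g_def)
      then have "g ` l \<in> \<Lambda>" using pres l by blast
      moreover have "f (g x) = x" if "x \<in> l" for x
        using bij[OF f] that l sub by (auto simp: g_def bij_betw_inv_into_right)
      then have "l = f ` g ` l" by (simp add: image_image)
      ultimately show ?thesis by (auto intro!: image_eqI[of _ _ "g ` l"])
    qed
    ultimately show ?thesis using pres f by (auto simp: Bij_def bij_betw_def)
  qed
  have "?\<Phi> \<in> hom ?M ?A"
  proof (rule homI)
    fix f assume "f \<in> carrier ?M"
    then have f: "f \<in> M" by simp
    have "f x \<in> f ` l \<longleftrightarrow> x \<in> l" if "x \<in> P" "l \<in> \<Lambda>" for x l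
      using inj_on_image_mem_iff[of f P x l] bij[OF f] that sub by (auto simp: bij_betw_def)
    then show "?\<Phi> f \<in> carrier ?A"
      using lines_Bij[OF f] M_Bij f by (auto simp: automorphism_group_of_def)
  next
    fix f g assume "f \<in> carrier ?M" "g \<in> carrier ?M"
    then have fg: "f \<in> M" "g \<in> M" by simp_all
    have "compose P f g ` l = f ` g ` l" if "l \<in> \<Lambda>" for l
    proof -
      have "compose P f g x = f (g x)" if "x \<in> l" for x using that \<open>l \<in> \<Lambda>\<close> sub by (auto simp: compose_def)
      then show ?thesis by (simp add: image_image)
    qed
    then have "(\<lambda>l\<in>\<Lambda>. compose P f g ` l) = compose \<Lambda> (\<lambda>l\<in>\<Lambda>. f ` l) (\<lambda>l\<in>\<Lambda>. g ` l)"
      by (intro extensionalityI[of _ \<Lambda>]) (auto simp: compose_eq pres[OF fg(2)])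
    then show "?\<Phi> (f \<otimes>\<^bsub>?M\<^esub> g) = ?\<Phi> f \<otimes>\<^bsub>?A\<^esub> ?\<Phi> g"
      using M_Bij fg lines_Bij by (auto simp: automorphism_group_of_def BijGroup_def DirProd_def)
  qed
  then have "group_hom ?M ?A ?\<Phi>"
    by (intro group_hom.intro group_hom_axioms.intro group_automorphism_group_of M.is_group)
  from group_hom.img_is_subgroup[OF this] show ?thesis by simp
qed

context field
begin

definition affine_map :: "'a \<Rightarrow> 'a \<Rightarrow> 'a \<Rightarrow> 'a" where
  "affine_map a v = (\<lambda>x\<in>carrier R. a \<otimes> x \<oplus> v)"

lemma compose_affine_map:
  assumes "a \<in> carrier R" "v \<in> carrier R" "b \<in> carrier R" "w \<in> carrier R"
  shows "compose (carrier R) (affine_map a v) (affine_map b w) = affine_map (a \<otimes> b) (a \<otimes> w \<oplus> v)"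
proof
  fix x
  have "a \<otimes> (b \<otimes> x \<oplus> w) \<oplus> v = a \<otimes> b \<otimes> x \<oplus> (a \<otimes> w \<oplus> v)" if "x \<in> carrier R"
    using assms that by algebra
  then show "compose (carrier R) (affine_map a v) (affine_map b w) x = affine_map (a \<otimes> b) (a \<otimes> w \<oplus> v) x"
    using assms by (simp add: compose_def affine_map_def)
qed

lemma affine_map_one_zero: "affine_map \<one> \<zero> = (\<lambda>x\<in>carrier R. x)"
  by (auto simp: affine_map_def restrict_def)

lemma subgroup_affine_maps:
  assumes C: "C \<subseteq> carrier R" "\<one> \<in> C" "\<And>a b. a \<in> C \<Longrightarrow> b \<in> C \<Longrightarrow> a \<otimes> b \<in> C"
    and inverse: "\<And>a. a \<in> C \<Longrightarrow> \<exists>b\<in>C. b \<otimes> a = \<one>"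
  shows "subgroup {affine_map a v | a v. a \<in> C \<and> v \<in> carrier R} (BijGroup (carrier R))" (is "subgroup ?M ?B")
proof -
  interpret B: group ?B by (rule group_BijGroup)
  have inv: "\<exists>b w. b \<in> C \<and> w \<in> carrier R \<and>
      compose (carrier R) (affine_map b w) (affine_map a v) = (\<lambda>x\<in>carrier R. x) \<and>
      compose (carrier R) (affine_map a v) (affine_map b w) = (\<lambda>x\<in>carrier R. x)"
    if a: "a \<in> C" and v: "v \<in> carrier R" for a v
  proof -
    obtain b where b: "b \<in> C" "b \<otimes> a = \<one>" using inverse a by blast
    have R: "a \<in> carrier R" "b \<in> carrier R" using a b C by auto
    have ab: "a \<otimes> b = \<one>" using b(2) R by (simp add: m_comm)
    have "b \<otimes> v \<oplus> \<ominus> (b \<otimes> v) = \<zero>" using R v by algebra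
    moreover have "a \<otimes> (\<ominus> (b \<otimes> v)) \<oplus> v = \<ominus> ((a \<otimes> b) \<otimes> v) \<oplus> v" using R v by algebra
    then have "a \<otimes> (\<ominus> (b \<otimes> v)) \<oplus> v = \<zero>" using v by (simp add: ab l_neg)
    ultimately show ?thesis
      using R v b ab by (intro exI[of _ b] exI[of _ "\<ominus> (b \<otimes> v)"])
        (simp add: compose_affine_map affine_map_one_zero)
  qed
  have maps: "affine_map a v \<in> carrier R \<rightarrow> carrier R" if "a \<in> C" "v \<in> carrier R" for a v
    using that C(1) by (auto simp: affine_map_def)
  have Bij: "affine_map a v \<in> Bij (carrier R)" if a: "a \<in> C" and v: "v \<in> carrier R" for a v
  proof -
    obtain b w where b: "b \<in> C" "w \<in> carrier R"
      and i: "compose (carrier R) (affine_map b w) (affine_map a v) = (\<lambda>x\<in>carrier R. x)"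
        "compose (carrier R) (affine_map a v) (affine_map b w) = (\<lambda>x\<in>carrier R. x)"
      using inv[OF a v] by blast
    have "bij_betw (affine_map a v) (carrier R) (carrier R)"
    proof (rule bij_betwI[where g = "affine_map b w"])
      show "affine_map a v \<in> carrier R \<rightarrow> carrier R" "affine_map b w \<in> carrier R \<rightarrow> carrier R"
        using maps a v b by blast+
      fix x assume x: "x \<in> carrier R"
      show "affine_map b w (affine_map a v x) = x" "affine_map a v (affine_map b w x) = x"
        using fun_cong[OF i(1), of x] fun_cong[OF i(2), of x] x by (simp_all add: compose_def)
    qed
    then show ?thesis by (simp add: Bij_def affine_map_def)
  qed
  show ?thesis
  proof (rule B.subgroupI)
    show "?M \<subseteq> carrier ?B" using Bij by (auto simp: BijGroup_def)
    show "?M \<noteq> {}" using C(2) by auto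
  next
    fix f assume "f \<in> ?M"
    then obtain a v where f: "f = affine_map a v" "a \<in> C" "v \<in> carrier R" by blast
    obtain b w where b: "b \<in> C" "w \<in> carrier R"
      and i: "compose (carrier R) (affine_map b w) (affine_map a v) = (\<lambda>x\<in>carrier R. x)"
      using inv[OF f(2,3)] by blast
    have "inv\<^bsub>?B\<^esub> f = affine_map b w"
      using i f b Bij by (intro B.inv_equality) (simp_all add: BijGroup_def)
    then show "inv\<^bsub>?B\<^esub> f \<in> ?M" using b by auto
  next
    fix f g assume "f \<in> ?M" "g \<in> ?M"
    then obtain a v b w where fg: "f = affine_map a v" "g = affine_map b w"
      "a \<in> C" "v \<in> carrier R" "b \<in> C" "w \<in> carrier R" by blast
    then have "f \<otimes>\<^bsub>?B\<^esub> g = affine_map (a \<otimes> b) (a \<otimes> w \<oplus> v)"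
      using Bij C(1) by (simp add: BijGroup_def compose_affine_map subset_iff)
    moreover have "a \<otimes> b \<in> C" "a \<otimes> w \<oplus> v \<in> carrier R" using fg C by auto
    ultimately show "f \<otimes>\<^bsub>?B\<^esub> g \<in> ?M" by blast
  qed
qed

lemma affine_map_in_AGammaL1:
  assumes "a \<in> carrier R" "a \<noteq> \<zero>" "v \<in> carrier R"
  shows "affine_map a v \<in> AGammaL1 R"
proof -
  have "(\<lambda>x. x) \<in> ring_iso R R"
    by (auto simp: ring_iso_def ring_hom_def bij_betw_def)
  then show ?thesis
    using assms unfolding AGammaL1_def affine_map_def mem_Collect_eq
    by (intro exI[of _ a] exI[of _ v] exI[of _ "\<lambda>x. x"]) simp
qed

lemma translation_maps_affine: "translation_maps R = {affine_map \<one> v | v. v \<in> carrier R}"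
  unfolding translation_maps_def affine_map_def by (auto simp: restrict_def fun_eq_iff)

end

section \<open>The linear space on the natural numbers\<close>

lemma isomorphic_desarguesian_planar_dilatable:
  assumes K: "field K" "finite (carrier K)"
    and iso: "isomorphic (set_space P \<Lambda>) (desarguesian_affine_space K)" and sub: "\<Lambda> \<subseteq> Pow P"
  shows "planar P \<Lambda> ((card (carrier K))\<^sup>2)" "dilatable P \<Lambda>"
proof -
  interpret K: field K by (rule K)
  have space: "desarguesian_affine_space K = set_space (vec3_carrier K) (lines (desarguesian_affine_space K))"
    by (simp add: desarguesian_affine_space_def)
  obtain g where g: "bij_betw g P (vec3_carrier K)" "lines (desarguesian_affine_space K) = (`) g ` \<Lambda>"
    using isomorphic_set_spaceE[OF _ sub K.desarguesian_lines_subset] iso space by metis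
  show "planar P \<Lambda> ((card (carrier K))\<^sup>2)"
    by (rule planar_pullback[OF g sub K.planar_desarguesian[OF K(2)]])
  show "dilatable P \<Lambda>"
    by (rule dilatable_pullback[OF g sub K.dilatable_desarguesian])
qed

context frobenius_tower
begin

definition F_ring :: "'a ring" where
  "F_ring = \<lparr>carrier = F, monoid.mult = (*), one = 1, ring.zero = 0, add = (+)\<rparr>"

lemma field_F_ring: "field F_ring"
proof -
  have "\<exists>y\<in>F. x + y = 0" if "x \<in> F" for x
    using uminus_F[OF that] by (intro bexI[of _ "- x"]) auto
  moreover have "\<exists>y\<in>F. x * y = 1" if "x \<in> F" "x \<noteq> 0" for x
    using inverse_fixed[OF that(1)] that(2) by (intro bexI[of _ "inverse x"]) auto
  ultimately show ?thesis
    unfolding F_ring_def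
    by unfold_locales
      (auto simp: algebra_simps Units_def add_F mult_fixed zero_F one_F)
qed

lemma coset_lines_affine_image:
  assumes c: "c \<in> norm_group" and v: "v \<in> F" and z: "z \<in> F" "z \<noteq> 0"
  shows "(\<lambda>x. c * x + v) ` (+) x ` part z = (+) (c * x + v) ` part (c * z)"
  unfolding part_mult[OF c z] image_image by (simp add: algebra_simps)

text \<open>
  An injection \<open>e\<close> carries both the linear space and the field structure of \<open>F\<close> over to the natural
  numbers. Flag-transitivity: to map \<open>x + part z\<close> to \<open>y + part z'\<close> and \<open>x\<close> to \<open>y\<close>, choose \<open>c\<close> with
  \<open>part z' = c * part z\<close> and follow multiplication by \<open>c\<close> by the translation with \<open>y - c * x\<close>.
\<close>

lemma model_on_naturals:
  fixes e :: "'a \<Rightarrow> nat"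
  assumes e: "inj_on e F"
  defines "L \<equiv> set_space (e ` F) ((`) e ` coset_lines)"
  shows "linear_space L" "card (points L) = q ^ 6"
    "\<forall>l\<in>lines L. card {x \<in> points L. inc L x l} = q ^ 2"
    "\<not> desarguesian q L"
    "\<exists>G. flag_transitive_group L G \<and> one_dimensional_affine L G"
proof -
  have sub: "coset_lines \<subseteq> Pow F" using coset_line_subset by blast
  have "card F = q ^ 6" using card_fixed[of 6] by simp
  then show "card (points L) = q ^ 6" using card_image[OF e] by (simp add: L_def)
  have "q ^ 1 < q ^ 6" using q_gt_1 by (intro power_strict_increasing) auto
  then have "F \<noteq> {0}" using \<open>card F = q ^ 6\<close> q_gt_1 by auto
  moreover have "q\<^sup>2 > 2"
  proof -
    have "2 * 2 \<le> q * q" using q_gt_1 by (intro mult_le_mono) auto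
    then show ?thesis by (simp add: power2_eq_square)
  qed
  ultimately show "linear_space L"
    unfolding L_def using linear_space_image[OF linear_space_cosets e sub] by blast
  have line_mem: "{x \<in> e ` F. x \<in> e ` l} = e ` l" if "l \<in> coset_lines" for l
    using that sub by blast
  have card_line: "card (e ` l) = q ^ 2" if "l \<in> coset_lines" for l
    using card_coset_line[OF that] card_image[OF inj_on_subset[OF e]] sub that by (metis Pow_iff subsetD)
  show "\<forall>l\<in>lines L. card {x \<in> points L. inc L x l} = q ^ 2"
    using line_mem card_line by (auto simp: L_def)
  show "\<not> desarguesian q L"
  proof
    assume "desarguesian q L"
    then obtain K :: "nat ring" where K: "field K" "card (carrier K) = q ^ 2"
      and iso: "isomorphic L (desarguesian_affine_space K)" by (auto simp: desarguesian_def)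
    have fin: "finite (carrier K)"
      using K(2) q_gt_1 by (intro card_ge_0_finite) simp
    have "(`) e ` coset_lines \<subseteq> Pow (e ` F)" using sub by blast
    note pd = isomorphic_desarguesian_planar_dilatable[OF K(1) fin iso[unfolded L_def] this]
    have bij: "bij_betw e F (e ` F)" using e by (simp add: bij_betw_def)
    show False
      using not_planar_dilatable planar_pullback[OF bij refl sub pd(1)] dilatable_pullback[OF bij refl sub pd(2)]
      unfolding K(2) by blast
  qed
  define R where "R = image_ring e F_ring"
  have carrier_F: "carrier F_ring = F" by (simp add: F_ring_def)
  interpret F: field F_ring by (rule field_F_ring)
  interpret R: field R
    unfolding R_def by (rule F.inj_imp_image_ring_is_field) (simp add: carrier_F e)
  have carrier_R: "carrier R = e ` F" by (simp add: R_def image_ring_carrier carrier_F)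
  have hom: "e \<in> ring_hom F_ring R"
    using inj_imp_image_ring_iso[of e F_ring] e unfolding R_def carrier_F by (simp add: ring_iso_def)
  have e_mult: "e x \<otimes>\<^bsub>R\<^esub> e y = e (x * y)" and e_add: "e x \<oplus>\<^bsub>R\<^esub> e y = e (x + y)" if "x \<in> F" "y \<in> F" for x y
    using ring_hom_mult[OF hom, of x y] ring_hom_add[OF hom, of x y] that by (simp_all add: F_ring_def)
  have e_one: "\<one>\<^bsub>R\<^esub> = e 1" using ring_hom_one[OF hom] by (simp add: F_ring_def)
  have e_zero: "\<zero>\<^bsub>R\<^esub> = e 0" by (simp add: R_def image_ring_zero F_ring_def)
  define M where "M = {R.affine_map a v | a v. a \<in> e ` norm_group \<and> v \<in> carrier R}"
  have M: "subgroup M (BijGroup (e ` F))"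
    unfolding M_def carrier_R[symmetric]
  proof (rule R.subgroup_affine_maps)
    show "e ` norm_group \<subseteq> carrier R" unfolding carrier_R using norm_group_F by blast
    show "\<one>\<^bsub>R\<^esub> \<in> e ` norm_group" unfolding e_one using norm_group_one by blast
    fix a assume "a \<in> e ` norm_group"
    then obtain c where c: "c \<in> norm_group" "a = e c" by blast
    then have cF: "c \<in> F" "inverse c \<in> F" "c \<noteq> 0"
      using norm_group_F norm_group_inverse norm_group_nonzero by auto
    then show "\<exists>b\<in>e ` norm_group. b \<otimes>\<^bsub>R\<^esub> a = \<one>\<^bsub>R\<^esub>"
      using c norm_group_inverse e_mult e_one by (intro bexI[of _ "e (inverse c)"]) auto
    fix b assume "b \<in> e ` norm_group"
    then obtain d where d: "d \<in> norm_group" "b = e d" by blast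
    then show "a \<otimes>\<^bsub>R\<^esub> b \<in> e ` norm_group"
      using c cF norm_group_F norm_group_mult e_mult[of c d] by auto
  qed
  have affine: "R.affine_map (e c) (e v) (e x) = e (c * x + v)"
    if "c \<in> norm_group" "v \<in> F" "x \<in> F" for c v x
  proof -
    have "c \<in> F" using that norm_group_F by blast
    then show ?thesis
      unfolding R.affine_map_def using that mult_fixed by (simp add: carrier_R e_mult e_add)
  qed
  have affine_image: "R.affine_map (e c) (e v) ` e ` (+) x ` part z = e ` (+) (c * x + v) ` part (c * z)"
    if "c \<in> norm_group" "v \<in> F" "x \<in> F" "z \<in> F" "z \<noteq> 0" for c v x z
  proof -
    have "(+) x ` part z \<subseteq> F" using coset_line_subset[OF coset_lineI] that by simp
    then have "R.affine_map (e c) (e v) ` e ` (+) x ` part z = e ` (\<lambda>x. c * x + v) ` (+) x ` part z"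
      unfolding image_image using affine[OF that(1,2)] by (intro image_cong) auto
    then show ?thesis using coset_lines_affine_image[OF that(1,2,4,5)] by simp
  qed
  have M_e: "M = {R.affine_map (e c) (e v) | c v. c \<in> norm_group \<and> v \<in> F}"
    unfolding M_def carrier_R by blast
  have pres: "f ` l \<in> (`) e ` coset_lines" if f: "f \<in> M" and l: "l \<in> (`) e ` coset_lines" for f l
  proof -
    obtain c v where c: "c \<in> norm_group" "v \<in> F" "f = R.affine_map (e c) (e v)"
      using f unfolding M_e by blast
    obtain x z where x: "x \<in> F" "z \<in> F" "z \<noteq> 0" "l = e ` (+) x ` part z"
      using l unfolding coset_lines_def by blast
    have cF: "c \<in> F" "c \<noteq> 0" using c norm_group_F norm_group_nonzero by auto
    have "f ` l = e ` (+) (c * x + v) ` part (c * z)" using affine_image c x by simp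
    moreover have "(+) (c * x + v) ` part (c * z) \<in> coset_lines"
      using c x cF mult_fixed add_F by (intro coset_lineI) auto
    ultimately show ?thesis by blast
  qed
  define G where "G = (\<lambda>f. (f, \<lambda>l\<in>(`) e ` coset_lines. f ` l)) ` M"
  have G: "subgroup G (automorphism_group_of L)"
    unfolding G_def L_def
    by (rule subgroup_automorphisms_from_points[OF M _ pres]) (use sub in blast)
  have trans: "\<exists>(g, h)\<in>G. g p = p' \<and> h l = n" if pl: "(p, l) \<in> flags L" and pn: "(p', n) \<in> flags L" for p p' l n
  proof -
    obtain x z where x: "x \<in> F" "p = e x" "z \<in> F" "z \<noteq> 0" "l = e ` (+) x ` part z"
    proof -
      obtain x l' where x: "x \<in> F" "p = e x" "l' \<in> coset_lines" "l = e ` l'" "e x \<in> e ` l'"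
        using pl by (auto simp: flags_def L_def)
      then have "x \<in> l'" using inj_on_image_mem_iff[OF e x(1)] sub by blast
      then obtain z where "z \<in> F" "z \<noteq> 0" "l' = (+) x ` part z" using coset_line_at[OF x(3)] by blast
      then show ?thesis using that x by blast
    qed
    obtain y z' where y: "y \<in> F" "p' = e y" "z' \<in> F" "z' \<noteq> 0" "n = e ` (+) y ` part z'"
    proof -
      obtain y l' where y: "y \<in> F" "p' = e y" "l' \<in> coset_lines" "n = e ` l'" "e y \<in> e ` l'"
        using pn by (auto simp: flags_def L_def)
      then have "y \<in> l'" using inj_on_image_mem_iff[OF e y(1)] sub by blast
      then obtain z where "z \<in> F" "z \<noteq> 0" "l' = (+) y ` part z" using coset_line_at[OF y(3)] by blast
      then show ?thesis using that y by blast
    qed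
    obtain c where c: "c \<in> norm_group" "part z' = (*) c ` part z"
      using parts_transitive[OF x(3,4) y(3,4)] by blast
    have "c * x \<in> F" using c x norm_group_F mult_fixed by blast
    define v where "v = y - c * x"
    have v: "v \<in> F" using y \<open>c * x \<in> F\<close> diff_F by (simp add: v_def)
    define f where "f = R.affine_map (e c) (e v)"
    have "f \<in> M" using c v unfolding M_e f_def by blast
    moreover have "f p = p'" using affine[OF c(1) v x(1)] x y by (simp add: f_def v_def)
    moreover have "f ` l = n"
      using affine_image[OF c(1) v x(1,3,4)] part_mult[OF c(1) x(3,4)] c(2) x y by (simp add: f_def v_def)
    moreover have "l \<in> (`) e ` coset_lines" using x coset_lineI by blast
    ultimately show ?thesis unfolding G_def by (intro bexI[of _ "(f, \<lambda>l\<in>(`) e ` coset_lines. f ` l)"]) auto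
  qed
  have ft: "flag_transitive_group L G"
    unfolding flag_transitive_group_def using G trans by auto
  have fst_G: "fst ` G = M" by (simp add: G_def image_image)
  have "one_dimensional_affine L G"
    unfolding one_dimensional_affine_def
  proof (intro conjI exI[of _ R])
    show "field R" by (rule R.field_axioms)
    show "carrier R = points L" by (simp add: carrier_R L_def)
    show "translation_maps R \<subseteq> fst ` G"
      unfolding fst_G R.translation_maps_affine M_def e_one using norm_group_one by blast
    show "fst ` G \<subseteq> AGammaL1 R"
    proof
      fix f assume "f \<in> fst ` G"
      then obtain c v where c: "c \<in> norm_group" "v \<in> F" "f = R.affine_map (e c) (e v)"
        unfolding fst_G M_e by blast
      then have cF: "c \<in> F" "c \<noteq> 0" using norm_group_F norm_group_nonzero by auto
      then have "e c \<noteq> e 0" using e zero_F by (auto dest: inj_onD)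
      then show "f \<in> AGammaL1 R"
        unfolding c(3) using c cF by (intro R.affine_map_in_AGammaL1) (auto simp: carrier_R e_zero)
    qed
  qed (rule G)
  then show "\<exists>G. flag_transitive_group L G \<and> one_dimensional_affine L G" using ft by blast
qed

end

lemma CHAR_finite_3: "CHAR(Enum.finite_3) = 3"
proof -
  have "of_nat 3 = (0 :: Enum.finite_3)" by (simp add: numeral_3_eq_3 plus_finite_3_def times_finite_3_def)
  then have "CHAR(Enum.finite_3) dvd 3" by (rule of_nat_eq_0_iff_char_dvd[THEN iffD1])
  moreover have "CHAR(Enum.finite_3) \<noteq> 1"
    using of_nat_eq_0_iff_char_dvd[of 1, where ?'a = Enum.finite_3] by simp
  moreover have "Factorial_Ring.prime (3::nat)" by simp
  ultimately show ?thesis using prime_nat_iff by blast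
qed

theorem theorem1p2:
  fixes k q :: nat
  assumes "k > 0" and "q = 3 ^ k"
  shows "\<exists>L :: (nat, nat set) incidence_structure.
    linear_space L \<and>
    card (points L) = q ^ 6 \<and>
    (\<forall>l\<in>lines L. card {x \<in> points L. inc L x l} = q ^ 2) \<and>
    flag_transitive L \<and>
    \<not> desarguesian q L \<and>
    (\<exists>G. flag_transitive_group L G \<and> one_dimensional_affine L G)"
proof -
  have q: "q > 1" unfolding assms(2) by (rule one_less_power[OF _ assms(1)]) simp
  obtain \<beta> :: "Enum.finite_3 alg_closure" where \<beta>: "\<beta> \<noteq> 0" "\<beta> ^ q = - \<beta>"
    using root_exists_minus_one[OF q] by blast
  obtain s :: "Enum.finite_3 alg_closure" where s: "s ^ q = s + 1"
    using artin_schreier_root_exists[OF q] by blast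
  have char: "CHAR(Enum.finite_3 alg_closure) = 3" using CHAR_finite_3 by simp
  interpret frobenius_tower q k \<beta> s
  proof
    fix j :: nat assume "j > 0"
    then show "card {x :: Enum.finite_3 alg_closure. x ^ (q ^ j) = x} = q ^ j"
      using card_frobenius_fixed[OF char _, of "k * j"] assms by (simp add: power_mult)
  qed (use assms \<beta> s char in auto)
  obtain e :: "Enum.finite_3 alg_closure \<Rightarrow> nat" where "inj_on e F"
    using finite_imp_inj_to_nat_seg[OF finite_F] by blast
  note model = model_on_naturals[OF this]
  from model(5) have "flag_transitive (set_space (e ` F) ((`) e ` coset_lines))"
    unfolding flag_transitive_def by blast
  then show ?thesis using model by blast
qed

end
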